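(* Let $k$ be a field, $V$ a finite-dimensional $k$-vector space and $G<\mathrm{GL}(V)$ a finite group. Let $U\subseteq V$ be a linear subspace and let $H=\{\sigma\in G:\ \sigma(u)=u \text{ for all } u\in U\}$ be its point-stabilizer. If the action of $G$ on $V$ has the direct summand property, then the action of $H$ on $V$ also has the direct summand property.
   Context: $k[V]$ denotes the coordinate ring of $V$, i.e. the symmetric algebra on the dual space $V^*$, graded by degree, with $G$ acting by graded algebra automorphisms; $k[V]^G$ is the ring of invariants. The action of $G$ on $V$ has the direct summand property if there is a surjective $k[V]^G$-linear map $\pi:k[V]\to k[V]^G$ respecting the gradings (equivalently, $k[V]^G$ is a direct summand of $k[V]$ as a graded $k[V]^G$-module). *)

theory Defs
  imports "HOL-Analysis.Analysis" "HOL-Library.Poly_Mapping"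
begin

text \<open>V = k^n, modelled as the type 'k^'n with 'n a finite index type;
linear maps of V are n x n matrices acting by *v.
The coordinate ring k[V] = Sym(V^*) is the polynomial ring in the coordinate
functions x_i (i :: 'n), represented as finitely supported maps from monomials
'n to nat) to coefficients.\<close>

type_synonym ('k, 'n) coord_ring = "('n \<Rightarrow>\<^sub>0 nat) \<Rightarrow>\<^sub>0 'k"

definition var :: "'n \<Rightarrow> ('k::field, 'n) coord_ring" where
  "var i = Poly_Mapping.single (Poly_Mapping.single i 1) 1"

definition const :: "'k \<Rightarrow> ('k::field, 'n) coord_ring" where
  "const c = Poly_Mapping.single 0 c"

text \<open>Pull-back along a linear map A: (subst A p)(v) = p(A v).
The coordinate function x_i composed with A is the linear form sum_j A_ij x_j.\<close>
definition subst :: "'k::field^'n::finite^'n \<Rightarrow> ('k, 'n) coord_ring \<Rightarrow> ('k, 'n) coord_ring" where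
  "subst A p = (\<Sum>m\<in>Poly_Mapping.keys p. const (Poly_Mapping.lookup p m) *
      (\<Prod>i\<in>UNIV. (\<Sum>j\<in>UNIV. const (A $ i $ j) * var j) ^ Poly_Mapping.lookup m i))"

text \<open>The action of sigma in GL(V) on k[V]: (sigma f)(v) = f(sigma^{-1} v).\<close>
definition act :: "'k::field^'n::finite^'n \<Rightarrow> ('k, 'n) coord_ring \<Rightarrow> ('k, 'n) coord_ring" where
  "act A p = subst (matrix_inv A) p"

definition invariants :: "('k::field^'n::finite^'n) set \<Rightarrow> ('k, 'n) coord_ring set" where
  "invariants G = {p. \<forall>A\<in>G. act A p = p}"

definition mon_deg :: "('n::finite \<Rightarrow>\<^sub>0 nat) \<Rightarrow> nat" where
  "mon_deg m = (\<Sum>i\<in>UNIV. Poly_Mapping.lookup m i)"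

definition homogeneous :: "nat \<Rightarrow> ('k::field, 'n::finite) coord_ring \<Rightarrow> bool" where
  "homogeneous d p \<longleftrightarrow> (\<forall>m\<in>Poly_Mapping.keys p. mon_deg m = d)"

definition finite_matrix_group :: "('k::field^'n::finite^'n) set \<Rightarrow> bool" where
  "finite_matrix_group G \<longleftrightarrow> finite G \<and> mat 1 \<in> G \<and>
     (\<forall>A\<in>G. \<forall>B\<in>G. A ** B \<in> G) \<and>
     (\<forall>A\<in>G. invertible A \<and> matrix_inv A \<in> G)"

definition direct_summand_property :: "('k::field^'n::finite^'n) set \<Rightarrow> bool" where
  "direct_summand_property G \<longleftrightarrow>
     (\<exists>\<pi> :: ('k, 'n) coord_ring \<Rightarrow> ('k, 'n) coord_ring.
        \<pi> ` UNIV = invariants G \<and>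
        (\<forall>p q. \<pi> (p + q) = \<pi> p + \<pi> q) \<and>
        (\<forall>a\<in>invariants G. \<forall>p. \<pi> (a * p) = a * \<pi> p) \<and>
        (\<forall>d p. homogeneous d p \<longrightarrow> homogeneous d (\<pi> p)))"

definition point_stabilizer ::
  "('k::field^'n::finite^'n) set \<Rightarrow> ('k^'n) set \<Rightarrow> ('k^'n^'n) set" where
  "point_stabilizer G U = {\<sigma>\<in>G. \<forall>u\<in>U. \<sigma> *v u = u}"

end

theory Submission
  imports Defs "HOL-Computational_Algebra.Polynomial"
begin

text \<open>
Write \<open>R = k[V]\<close>, and let \<open>A \<subseteq> B \<subseteq> R\<close> be the invariants of \<open>G\<close> and of the stabilizer \<open>H\<close>. After adjoining
a variable \<open>T\<close> there is a point \<open>\<gamma> \<in> U \<otimes> k[T]\<close> whose stabilizer in \<open>G\<close> is exactly \<open>H\<close>; this avoids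
extending the field when \<open>k\<close> is finite. Choose an \<open>H\<close>-invariant \<open>b\<close> that vanishes at \<open>\<sigma>\<gamma>\<close> for all
\<open>\<sigma> \<in> G - H\<close> but not at \<open>\<gamma>\<close>, and let \<open>F = \<Sum>\<^sub>i F\<^sub>i X\<^sup>i\<close> be the product of \<open>X - y\<close> over the \<open>G\<close>-conjugates
\<open>y \<noteq> b\<close> of \<open>b\<close>. From a projection \<open>\<pi> : R \<rightarrow> A\<close> form the \<open>A\<close>-linear map \<open>\<psi> = \<Sum>\<^sub>y \<pi> \<circ> \<rho>\<^sub>y\<close>, where \<open>\<rho>\<^sub>y\<close> moves
\<open>b\<close> to \<open>y\<close>, and put \<open>\<phi>(x) = \<Sum>\<^sub>i F\<^sub>i \<psi>(b\<^sup>i x)\<close>. It has values in \<open>B\<close>. It commutes with multiplication by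
\<open>b\<close> because \<open>(X - b) F\<close> has coefficients in \<open>A\<close> and kills \<open>b\<close>; Lagrange interpolation at the conjugates of
\<open>b\<close> expresses \<open>F(b) c\<close>, for \<open>c \<in> B\<close>, as a polynomial in \<open>b\<close> over \<open>A\<close>, so \<open>\<phi>\<close> is \<open>B\<close>-linear. At \<open>\<gamma>\<close> the
polynomial \<open>F\<close> specializes to \<open>X\<^sup>m\<close>, which gives \<open>\<phi>(1)(\<gamma>) = b(\<gamma>)\<^sup>m \<noteq> 0\<close>.

Translation by \<open>\<gamma>\<close> commutes with \<open>H\<close>. Conjugating \<open>\<phi>\<close> with it yields a \<open>B\<close>-linear map whose value at 1
has a non-zero constant term. A suitable \<open>T\<close>-coefficient of its degree-preserving part, rescaled, is
the required projection onto \<open>B\<close>.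
\<close>

section \<open>Linear maps over the invariants of a stabilizer\<close>

locale unital_hom =
  fixes f :: "'a::comm_ring_1 \<Rightarrow> 'b::comm_ring_1"
  assumes one [simp]: "f 1 = 1"
    and add: "f (x + y) = f x + f y"
    and mult: "f (x * y) = f x * f y"
begin

lemma zero [simp]: "f 0 = 0"
  using add[of 0 0] by simp

lemma uminus: "f (- x) = - f x"
  using add[of x "- x"] by (simp add: eq_neg_iff_add_eq_0 add.commute)

lemma diff: "f (x - y) = f x - f y"
  using add[of x "- y"] by (simp add: uminus)

lemma sum: "f (sum g A) = (\<Sum>x\<in>A. f (g x))"
  by (induction A rule: infinite_finite_induct) (auto simp: add)

lemma prod: "f (prod g A) = (\<Prod>x\<in>A. f (g x))"
  by (induction A rule: infinite_finite_induct) (auto simp: mult)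

lemma power: "f (x ^ n) = f x ^ n"
  by (induction n) (auto simp: mult)

lemma map_poly_pCons [simp]: "map_poly f (pCons a p) = pCons (f a) (map_poly f p)"
  by (rule poly_eqI) (simp add: coeff_map_poly coeff_pCons split: nat.split)

lemma map_poly_unital_hom: "unital_hom (map_poly f)"
proof
  fix p q :: "'a poly"
  show "map_poly f (p + q) = map_poly f p + map_poly f q"
    by (rule poly_eqI) (simp add: coeff_map_poly add)
  show "map_poly f (p * q) = map_poly f p * map_poly f q"
    by (rule poly_eqI) (simp add: coeff_map_poly coeff_mult sum mult)
qed (simp add: map_poly_1')

lemma poly_map_poly: "poly (map_poly f p) (f x) = f (poly p x)"
  by (induction p) (auto simp: add mult)

end

lemma unital_hom_comp:
  assumes "unital_hom f" "unital_hom g"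
  shows "unital_hom (\<lambda>x. f (g x))"
proof -
  interpret f: unital_hom f by fact
  interpret g: unital_hom g by fact
  show ?thesis by unfold_locales (simp_all add: f.add f.mult g.add g.mult)
qed

lemma unital_hom_poly: "unital_hom (\<lambda>p. poly p x)"
  by unfold_locales simp_all

lemma unital_hom_const_poly: "unital_hom (\<lambda>c. [:c:])"
  by unfold_locales simp_all

section \<open>Fixed rings and the linear map over them\<close>

definition fixed_by :: "('s \<Rightarrow> 's) set \<Rightarrow> 's set" where
  "fixed_by G = {a. \<forall>f\<in>G. f a = a}"

lemma fixed_byI: "(\<And>f. f \<in> G \<Longrightarrow> f a = a) \<Longrightarrow> a \<in> fixed_by G"
  and fixed_byD: "a \<in> fixed_by G \<Longrightarrow> f \<in> G \<Longrightarrow> f a = a"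
  by (auto simp: fixed_by_def)

text \<open>The homomorphism \<open>ev\<close> plays the role of evaluation at a point with stabilizer \<open>H\<close>.\<close>

locale separated_stabilizer =
  fixes G H :: "('s::comm_ring_1 \<Rightarrow> 's) set"
    and \<pi> :: "'s \<Rightarrow> 's"
    and ev :: "'s \<Rightarrow> 'd::idom"
  assumes finite_G: "finite G"
    and id_G: "id \<in> G"
    and comp_G: "f \<in> G \<Longrightarrow> g \<in> G \<Longrightarrow> f \<circ> g \<in> G"
    and inv_G: "f \<in> G \<Longrightarrow> \<exists>g\<in>G. g \<circ> f = id"
    and hom_G: "f \<in> G \<Longrightarrow> unital_hom f"
    and H_sub: "H \<subseteq> G"
    and id_H: "id \<in> H"
    and comp_H: "f \<in> H \<Longrightarrow> g \<in> H \<Longrightarrow> f \<circ> g \<in> H"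
    and inv_H: "f \<in> H \<Longrightarrow> \<exists>g\<in>H. g \<circ> f = id \<and> f \<circ> g = id"
    and proj_add: "\<pi> (x + y) = \<pi> x + \<pi> y"
    and proj_mult: "a \<in> fixed_by G \<Longrightarrow> \<pi> (a * x) = a * \<pi> x"
    and proj_fixed: "\<pi> x \<in> fixed_by G"
    and proj_one: "\<pi> 1 = 1"
    and ev_hom: "unital_hom ev"
    and ev_H: "f \<in> H \<Longrightarrow> ev (f x) = ev x"
    and ev_sep: "f \<in> G \<Longrightarrow> f \<notin> H \<Longrightarrow> \<exists>g. ev (f g) = 0 \<and> ev g \<noteq> 0"
    and ev_cancel: "ev s \<noteq> 0 \<Longrightarrow> s * x = 0 \<Longrightarrow> x = 0"
begin

lemma hom_H: "f \<in> H \<Longrightarrow> unital_hom f"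
  using H_sub hom_G by blast

text \<open>For each \<open>f\<close> outside \<open>H\<close> a separating element
  \<open>w f\<close> is available; \<open>ev\<close> kills the product \<open>g\<close> of all of
  them after any such \<open>f\<close>, and the norm of \<open>g\<close> over \<open>H\<close> is
  invariant. As \<open>ev\<close> is unchanged by \<open>H\<close>, this norm evaluates to a power
  of \<open>ev g\<close>, which is non-zero in a domain.\<close>

lemma exists_separating_invariant:
  "\<exists>b \<in> fixed_by H. ev b \<noteq> 0 \<and> (\<forall>f\<in>G - H. ev (f b) = 0)"
proof -
  interpret ev: unital_hom ev by (rule ev_hom)
  have finite_H: "finite H" using finite_G H_sub finite_subset by blast
  obtain w where w: "ev (f (w f)) = 0" "ev (w f) \<noteq> 0" if "f \<in> G - H" for f
    using ev_sep by (metis DiffE)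
  define g where "g = (\<Prod>f\<in>G-H. w f)"
  define b where "b = (\<Prod>h\<in>H. h g)"
  have evg: "ev g \<noteq> 0"
    unfolding g_def ev.prod using w finite_G by simp
  have evfg: "ev (f g) = 0" if f: "f \<in> G - H" for f
  proof -
    interpret f: unital_hom f using f hom_G by blast
    show ?thesis unfolding g_def f.prod ev.prod
      using w f finite_G by (intro prod_zero) auto
  qed
  have "ev b = ev g ^ card H"
    unfolding b_def ev.prod by (simp add: ev_H)
  then have evb: "ev b \<noteq> 0" using evg by simp
  have evfb: "ev (f b) = 0" if f: "f \<in> G - H" for f
  proof -
    interpret f: unital_hom f using f hom_G by blast
    show ?thesis
      unfolding b_def f.prod ev.prod using finite_H id_H evfg[OF f]
      by (intro prod_zero) (auto intro!: bexI[of _ id])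
  qed
  have "b \<in> fixed_by H"
  proof (rule fixed_byI)
    fix f assume f: "f \<in> H"
    interpret f: unital_hom f using f hom_H by blast
    obtain f' where f': "f' \<in> H" "f' \<circ> f = id" "f \<circ> f' = id" using inv_H f by blast
    have "bij_betw (\<lambda>h. f \<circ> h) H H"
      by (rule bij_betw_byWitness[where f' = "\<lambda>h. f' \<circ> h"])
         (use f f' comp_H in \<open>auto simp: o_assoc\<close>)
    from prod.reindex_bij_betw[OF this, of "\<lambda>h. h g"]
    show "f b = b" unfolding b_def f.prod by simp
  qed
  then show ?thesis using evb evfb by blast
qed

text \<open>Linearity over the larger fixed ring is first obtained up to the factor
  \<open>poly F b\<close>. Its image under \<open>ev\<close> is a power of \<open>ev b\<close>, so
  \<open>ev_cancel\<close> removes it.\<close>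

lemma exists_linear_map_nonvanishing:
  "\<exists>\<phi>. (\<forall>x y. \<phi> (x + y) = \<phi> x + \<phi> y) \<and> (\<forall>c\<in>fixed_by H. \<forall>x. \<phi> (c * x) = c * \<phi> x)
     \<and> (\<forall>x. \<phi> x \<in> fixed_by H) \<and> ev (\<phi> 1) \<noteq> 0"
proof -
  interpret ev: unital_hom ev by (rule ev_hom)
  obtain b where b: "b \<in> fixed_by H" and evb: "ev b \<noteq> 0"
    and evfb: "\<And>f. f \<in> G - H \<Longrightarrow> ev (f b) = 0"
    using exists_separating_invariant by blast
  define Orb where "Orb = (\<lambda>f. f b) ` G"
  have fin: "finite Orb" by (simp add: Orb_def finite_G)
  have bO: "b \<in> Orb" unfolding Orb_def using id_G by (intro image_eqI[of _ _ id]) auto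
  \<comment> \<open>Together with \<open>b \<in> fixed_by H\<close> this makes \<open>H\<close> the
    full stabilizer of \<open>b\<close>.\<close>
  have stab: "f \<in> H" if "f \<in> G" "f b = b" for f
    using that evfb[of f] evb by auto
  have evO: "ev y = 0" if "y \<in> Orb - {b}" for y
    using that b evfb fixed_byD unfolding Orb_def by fastforce
  have inj: "inj f" if f: "f \<in> G" for f
    using inv_G[OF f] by (metis inj_on_id inj_on_imageI2)
  have perm: "bij_betw f Orb Orb" if f: "f \<in> G" for f
  proof -
    have "inj_on f Orb" using inj[OF f] by (rule inj_on_subset) simp
    moreover have "f ` Orb \<subseteq> Orb"
    proof safe
      fix z assume "z \<in> Orb"
      then obtain g where "g \<in> G" "z = g b" unfolding Orb_def by blast
      then show "f z \<in> Orb"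
        unfolding Orb_def using comp_G[OF f] by (intro image_eqI[of _ _ "f \<circ> g"]) auto
    qed
    ultimately show ?thesis
      using endo_inj_surj[OF fin] by (simp add: bij_betw_def)
  qed
  have "\<forall>y\<in>Orb. \<exists>f. f \<in> G \<and> f b = y" by (auto simp: Orb_def)
  from bchoice[OF this] obtain \<rho> where \<rho>: "\<And>y. y \<in> Orb \<Longrightarrow> \<rho> y \<in> G" "\<And>y. y \<in> Orb \<Longrightarrow> \<rho> y b = y"
    by blast
  \<comment> \<open>\<open>f\<close> and \<open>f'\<close> differ by an element of the stabilizer of
    \<open>b\<close>, which lies in \<open>H\<close> and so fixes \<open>c\<close>. Hence each
    conjugate of \<open>b\<close> determines a conjugate of \<open>c\<close>, whatever
    representatives are chosen.\<close>
  have conj: "f c = f' c" if "f \<in> G" "f' \<in> G" "f b = f' b" "c \<in> fixed_by H" for f f' c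
  proof -
    obtain k where k: "k \<in> G" "k \<circ> f = id" using inv_G \<open>f \<in> G\<close> by blast
    have "(k \<circ> f') b = b" using k that by (metis comp_apply id_apply)
    then have "k \<circ> f' \<in> H" using stab comp_G k that by blast
    then have "k (f' c) = c" using fixed_byD[OF that(4)] by fastforce
    also have "c = k (f c)" using k by (metis comp_apply id_apply)
    finally show ?thesis using inj[OF k(1)] by (simp add: inj_eq)
  qed
  define lin where "lin z = [:- z, 1:]" for z :: 's
  define F where "F = (\<Prod>z\<in>Orb-{b}. lin z)"
  \<comment> \<open>Lagrange interpolation with cleared denominators: the value at \<open>y\<close>
    is \<open>\<rho> y c\<close> times the product of \<open>y - z\<close> over the other
    conjugates.\<close>
  define Q where "Q c = (\<Sum>y\<in>Orb. [:\<rho> y c:] * (\<Prod>z\<in>Orb-{y}. lin z))" for c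
  define inv_poly where "inv_poly q \<longleftrightarrow> (\<forall>i. coeff q i \<in> fixed_by G)" for q :: "'s poly"
  have inv_polyI: "inv_poly q" if "\<And>f. f \<in> G \<Longrightarrow> map_poly f q = q" for q
    unfolding inv_poly_def
  proof (intro allI fixed_byI)
    fix i f assume f: "f \<in> G"
    interpret f: unital_hom f using f hom_G by blast
    show "f (coeff q i) = coeff q i"
      using that[OF f] by (metis coeff_map_poly f.zero)
  qed
  have map_lin: "map_poly f (\<Prod>z\<in>Z. lin z) = (\<Prod>z\<in>f ` Z. lin z)" if f: "f \<in> G" for f Z
  proof -
    interpret f: unital_hom f using f hom_G by blast
    interpret mf: unital_hom "map_poly f" by (rule f.map_poly_unital_hom)
    have "inj_on f Z" using inj[OF f] by (rule inj_on_subset) simp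
    then show ?thesis
      by (simp add: mf.prod prod.reindex lin_def f.uminus)
  qed
  have P: "inv_poly (\<Prod>z\<in>Orb. lin z)"
    by (intro inv_polyI) (simp add: map_lin bij_betw_imp_surj_on[OF perm])
  \<comment> \<open>By \<open>conj\<close>, an element of \<open>G\<close> only permutes the
    summands of \<open>Q c\<close>.\<close>
  have QA: "inv_poly (Q c)" if c: "c \<in> fixed_by H" for c
  proof (rule inv_polyI)
    fix f assume f: "f \<in> G"
    interpret f: unital_hom f using f hom_G by blast
    interpret mf: unital_hom "map_poly f" by (rule f.map_poly_unital_hom)
    have *: "[:f (\<rho> y c):] * (\<Prod>z\<in>f ` (Orb-{y}). lin z)
           = [:\<rho> (f y) c:] * (\<Prod>z\<in>Orb-{f y}. lin z)" if y: "y \<in> Orb" for y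
    proof -
      have fy: "f y \<in> Orb" using perm[OF f] y bij_betwE by blast
      have "(f \<circ> \<rho> y) c = \<rho> (f y) c"
        using \<rho>[OF y] \<rho>[OF fy] comp_G[OF f] conj[of "f \<circ> \<rho> y" "\<rho> (f y)" c] c by simp
      moreover have "f ` (Orb - {y}) = Orb - {f y}"
        using inj[OF f] perm[OF f] by (simp add: image_set_diff bij_betw_imp_surj_on)
      ultimately show ?thesis by simp
    qed
    have "map_poly f (Q c) = (\<Sum>y\<in>Orb. [:\<rho> (f y) c:] * (\<Prod>z\<in>Orb-{f y}. lin z))"
      unfolding Q_def mf.sum mf.mult map_lin[OF f] f.map_poly_pCons map_poly_0
      by (intro sum.cong refl) (rule *)
    also have "\<dots> = Q c"
      unfolding Q_def by (rule sum.reindex_bij_betw[OF perm[OF f]])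
    finally show "map_poly f (Q c) = Q c" .
  qed
  \<comment> \<open>At \<open>b\<close> only the summand \<open>y = b\<close> survives; the others
    contain the factor \<open>b - b\<close>.\<close>
  have Qb: "poly (Q c) b = c * poly F b" if c: "c \<in> fixed_by H" for c
  proof -
    have "poly (Q c) b = (\<Sum>y\<in>Orb. \<rho> y c * (\<Prod>z\<in>Orb-{y}. b - z))"
      unfolding Q_def by (simp add: poly_sum poly_prod lin_def)
    also have "\<dots> = \<rho> b c * (\<Prod>z\<in>Orb-{b}. b - z)
        + (\<Sum>y\<in>Orb-{b}. \<rho> y c * (\<Prod>z\<in>Orb-{y}. b - z))"
      by (rule sum.remove[OF fin bO])
    also have "(\<Sum>y\<in>Orb-{b}. \<rho> y c * (\<Prod>z\<in>Orb-{y}. b - z)) = 0"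
    proof (rule sum.neutral, rule ballI)
      fix y assume "y \<in> Orb - {b}"
      then have "(\<Prod>z\<in>Orb-{y}. b - z) = 0"
        using fin bO by (intro prod_zero) auto
      then show "\<rho> y c * (\<Prod>z\<in>Orb-{y}. b - z) = 0" by simp
    qed
    also have "\<rho> b c = c" using stab \<rho>[OF bO] c fixed_byD by metis
    finally show ?thesis by (simp add: F_def poly_prod lin_def)
  qed
  have proj_sum: "\<pi> (sum u Z) = (\<Sum>z\<in>Z. \<pi> (u z))" for u and Z :: "'s set"
  proof -
    have "\<pi> 0 = 0" using proj_add[of 0 0] by simp
    then show ?thesis
      by (induction Z rule: infinite_finite_induct) (auto simp: proj_add)
  qed
  define \<psi> where "\<psi> x = (\<Sum>y\<in>Orb. \<pi> (\<rho> y x))" for x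
  have \<psi>_add: "\<psi> (x + y) = \<psi> x + \<psi> y" for x y
    unfolding \<psi>_def using \<rho>(1) hom_G
    by (simp add: sum.distrib[symmetric] proj_add[symmetric] unital_hom.add)
  have \<psi>_mult: "\<psi> (a * x) = a * \<psi> x" if "a \<in> fixed_by G" for a x
    unfolding \<psi>_def sum_distrib_left
    by (intro sum.cong refl) (metis \<rho>(1) hom_G unital_hom.mult fixed_byD that proj_mult)
  have \<psi>_zero: "\<psi> 0 = 0" using \<psi>_add[of 0 0] by simp
  have \<psi>_sum: "\<psi> (sum u N) = (\<Sum>i\<in>N. \<psi> (u i))" for u and N :: "nat set"
    by (induction N rule: infinite_finite_induct) (auto simp: \<psi>_zero \<psi>_add)
  have \<psi>_fixed: "\<psi> x \<in> fixed_by G" for x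
  proof (rule fixed_byI)
    fix f assume f: "f \<in> G"
    interpret f: unital_hom f using f hom_G by blast
    show "f (\<psi> x) = \<psi> x" unfolding \<psi>_def f.sum using fixed_byD[OF proj_fixed f] by simp
  qed
  \<comment> \<open>Pairs the coefficients of \<open>q\<close> with the moments
    \<open>\<psi> (b ^ i * x)\<close>. When these coefficients are invariant, linearity of
    \<open>\<psi>\<close> collapses the sum to \<open>\<psi> (poly q b * x)\<close>.\<close>
  define L where "L q x = (\<Sum>i\<le>degree q. coeff q i * \<psi> (b ^ i * x))" for q x
  have L_le: "L q x = (\<Sum>i\<le>N. coeff q i * \<psi> (b ^ i * x))" if "degree q \<le> N" for q x N
    unfolding L_def using that by (intro sum.mono_neutral_left) (auto simp: coeff_eq_0)
  have L_inv: "L q x = \<psi> (poly q b * x)" if "inv_poly q" for q x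
  proof -
    have "L q x = (\<Sum>i\<le>degree q. \<psi> (coeff q i * (b ^ i * x)))"
      unfolding L_def using that by (simp add: \<psi>_mult inv_poly_def)
    also have "\<dots> = \<psi> (poly q b * x)"
      by (simp add: \<psi>_sum[symmetric] poly_altdef sum_distrib_right mult.assoc)
    finally show ?thesis .
  qed
  define \<phi> where "\<phi> = L F"
  have \<phi>_add: "\<phi> (x + y) = \<phi> x + \<phi> y" for x y
    unfolding \<phi>_def L_def by (simp add: distrib_left \<psi>_add sum.distrib)
  have \<phi>_zero: "\<phi> 0 = 0" using \<phi>_add[of 0 0] by simp
  have \<phi>_sum: "\<phi> (sum u N) = (\<Sum>i\<in>N. \<phi> (u i))" for u and N :: "nat set"
    by (induction N rule: infinite_finite_induct) (auto simp: \<phi>_zero \<phi>_add)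
  have \<phi>_A: "\<phi> (a * x) = a * \<phi> x" if "a \<in> fixed_by G" for a x
  proof -
    have "\<psi> (b ^ i * (a * x)) = a * \<psi> (b ^ i * x)" for i
      using \<psi>_mult[OF that, of "b ^ i * x"] by (simp add: mult_ac)
    then show ?thesis unfolding \<phi>_def L_def by (simp add: sum_distrib_left mult_ac)
  qed
  have \<phi>_b: "\<phi> (b * x) = b * \<phi> x" for x
  proof -
    \<comment> \<open>\<open>?P\<close> is F times the factor X - b. It has invariant coefficients
      and the root \<open>b\<close>, so \<open>L ?P x\<close> is zero; expanding the product gives
      \<open>\<phi> (b * x) - b * \<phi> x\<close> for the same quantity.\<close>
    let ?P = "\<Prod>z\<in>Orb. lin z"
    have PF: "?P = pCons 0 F - smult b F"
      using prod.remove[OF fin bO, of lin] by (simp add: F_def lin_def)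
    have deg: "degree ?P \<le> Suc (degree F)"
      unfolding PF by (intro degree_diff_le) (auto intro: degree_smult_le[THEN le_trans])
    \<comment> \<open>The zero constant coefficient drops out, and the index shift moves one power
      of \<open>b\<close> into the argument \<open>b * x\<close>.\<close>
    have 1: "(\<Sum>i\<le>Suc (degree F). coeff (pCons 0 F) i * \<psi> (b ^ i * x)) = \<phi> (b * x)"
      unfolding \<phi>_def L_def
      by (subst sum.atMost_Suc_shift) (simp add: mult_ac)
    have 2: "(\<Sum>i\<le>Suc (degree F). coeff (smult b F) i * \<psi> (b ^ i * x)) = b * \<phi> x"
      unfolding \<phi>_def L_def by (simp add: sum_distrib_left mult_ac coeff_eq_0)
    have "L ?P x = \<phi> (b * x) - b * \<phi> x"
      unfolding L_le[OF deg] 1[symmetric] 2[symmetric]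
      by (simp only: PF coeff_diff left_diff_distrib sum_subtractf)
    moreover have "poly ?P b = 0" by (simp add: PF)
    ultimately show ?thesis using L_inv[OF P, of x] \<psi>_zero by simp
  qed
  have \<phi>_power: "\<phi> (b ^ n * x) = b ^ n * \<phi> x" for n x
    by (induction n) (simp_all add: mult.assoc \<phi>_b)
  have \<phi>_poly: "\<phi> (poly q b * x) = poly q b * \<phi> x" if "inv_poly q" for q x
  proof -
    have "\<phi> (poly q b * x) = (\<Sum>i\<le>degree q. \<phi> (coeff q i * (b ^ i * x)))"
      by (simp add: \<phi>_sum[symmetric] poly_altdef sum_distrib_right mult.assoc)
    also have "\<dots> = poly q b * \<phi> x"
      using that
      by (simp add: \<phi>_A inv_poly_def \<phi>_power poly_altdef sum_distrib_right mult.assoc)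
    finally show ?thesis .
  qed
  have one_fixed: "1 \<in> fixed_by H"
    using hom_H unital_hom.one by (intro fixed_byI) blast
  have evF: "map_poly ev F = monom 1 (card (Orb - {b}))"
  proof -
    interpret m: unital_hom "map_poly ev" by (rule ev.map_poly_unital_hom)
    have "map_poly ev F = (\<Prod>z\<in>Orb-{b}. [:0, 1:])"
      unfolding F_def m.prod by (intro prod.cong refl) (simp add: lin_def evO ev.uminus)
    then show ?thesis by (simp add: monom_altdef)
  qed
  have "ev (poly F b) = ev b ^ card (Orb - {b})"
    using ev.poly_map_poly[of F b] evF by (simp add: poly_monom)
  then have evFb: "ev (poly F b) \<noteq> 0" using evb by simp
  have \<phi>_B: "\<phi> (c * x) = c * \<phi> x" if c: "c \<in> fixed_by H" for c x
  proof -
    \<comment> \<open>\<open>F\<close> need not have \<open>G\<close>-invariant coefficients, so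
      \<open>\<phi>_poly\<close> is applied to \<open>Q 1\<close>, which has them and takes the same
      value at \<open>b\<close>.\<close>
    have "poly F b * \<phi> (c * x) = poly (Q 1) b * \<phi> (c * x)"
      by (simp add: Qb one_fixed)
    also have "\<dots> = \<phi> (poly (Q 1) b * (c * x))"
      by (simp only: \<phi>_poly[OF QA[OF one_fixed]])
    also have "\<dots> = \<phi> (poly (Q c) b * x)"
      by (simp add: Qb one_fixed c mult_ac)
    also have "\<dots> = poly (Q c) b * \<phi> x"
      by (rule \<phi>_poly[OF QA[OF c]])
    also have "\<dots> = poly F b * (c * \<phi> x)"
      by (simp add: c Qb mult_ac)
    finally have "poly F b * (\<phi> (c * x) - c * \<phi> x) = 0" by (simp add: right_diff_distrib)
    then show ?thesis using ev_cancel[OF evFb] by (metis eq_iff_diff_eq_0)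
  qed
  \<comment> \<open>\<open>H\<close> fixes \<open>b\<close> and permutes the other conjugates, so
    the coefficients of \<open>F\<close> are \<open>H\<close>-invariant; the values of
    \<open>\<psi>\<close> are even \<open>G\<close>-invariant.\<close>
  have \<phi>_fixed: "\<phi> x \<in> fixed_by H" for x
  proof (rule fixed_byI)
    fix f assume f: "f \<in> H"
    then have fG: "f \<in> G" using H_sub by blast
    interpret f: unital_hom f using f hom_H by blast
    have "f ` (Orb - {b}) = Orb - {b}"
      using inj[OF fG] perm[OF fG] fixed_byD[OF b f]
      by (simp add: image_set_diff bij_betw_imp_surj_on)
    then have "map_poly f F = F" unfolding F_def map_lin[OF fG] by simp
    then have "f (coeff F i) = coeff F i" for i by (metis coeff_map_poly f.zero)
    then show "f (\<phi> x) = \<phi> x"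
      unfolding \<phi>_def L_def f.sum f.mult using fixed_byD[OF \<psi>_fixed fG] by simp
  qed
  have "ev (\<phi> 1) \<noteq> 0"
  proof -
    let ?m = "card (Orb - {b})"
    have evc: "ev (coeff F i) = (if i = ?m then 1 else 0)" for i
      using arg_cong[OF evF, of "\<lambda>p. coeff p i"] by (simp add: coeff_map_poly)
    have "?m \<le> degree F" using evc[of ?m] by (metis ev.zero le_degree zero_neq_one)
    \<comment> \<open>Only the coefficient of index \<open>?m\<close> survives \<open>ev\<close>.
      There \<open>\<psi> (b ^ ?m)\<close> is the projection of a power sum of all conjugates, an
      invariant that \<open>\<pi>\<close> leaves unchanged.\<close>
    have "ev (\<phi> 1) = (\<Sum>i\<le>degree F. if i = ?m then ev (\<psi> (b ^ i)) else 0)"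
      unfolding \<phi>_def L_def ev.sum by (intro sum.cong refl) (simp add: ev.mult evc)
    also have "\<dots> = ev (\<psi> (b ^ ?m))" using \<open>?m \<le> degree F\<close> by simp
    also have "\<psi> (b ^ ?m) = \<pi> (\<Sum>y\<in>Orb. y ^ ?m)"
      unfolding \<psi>_def proj_sum
      by (intro sum.cong refl) (metis \<rho> hom_G unital_hom.power)
    also have "\<dots> = (\<Sum>y\<in>Orb. y ^ ?m)"
    proof -
      have "(\<Sum>y\<in>Orb. y ^ ?m) \<in> fixed_by G"
      proof (rule fixed_byI)
        fix f assume f: "f \<in> G"
        interpret f: unital_hom f using f hom_G by blast
        show "f (\<Sum>y\<in>Orb. y ^ ?m) = (\<Sum>y\<in>Orb. y ^ ?m)"
          unfolding f.sum f.power by (rule sum.reindex_bij_betw[OF perm[OF f]])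
      qed
      from proj_mult[OF this, of 1] show ?thesis by (simp add: proj_one)
    qed
    also have "ev (\<Sum>y\<in>Orb. y ^ ?m) = ev b ^ ?m + (\<Sum>y\<in>Orb-{b}. ev y ^ ?m)"
      unfolding ev.sum ev.power by (rule sum.remove[OF fin bO])
    also have "(\<Sum>y\<in>Orb-{b}. ev y ^ ?m) = 0"
    proof (rule sum.neutral, rule ballI)
      fix y assume y: "y \<in> Orb - {b}"
      \<comment> \<open>A conjugate other than \<open>b\<close> exists here, so the exponent is
        positive; for \<open>?m = 0\<close> the sum is empty.\<close>
      then have "?m > 0" using fin by (auto simp: card_gt_0_iff)
      then show "ev y ^ ?m = 0" using evO[OF y] by simp
    qed
    finally show ?thesis using evb by simp
  qed
  then show ?thesis using \<phi>_add \<phi>_B \<phi>_fixed by blast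
qed

end

section \<open>Homomorphisms from the coordinate ring\<close>

text \<open>For a unital homomorphism \<open>h\<close> this is the map from the universal property
  of the polynomial ring: \<open>h\<close> on scalars, \<open>g\<close> on variables. The action,
  evaluation at a point and translation are all instances.\<close>

definition evalp ::
  "('k::field \<Rightarrow> 'c::comm_ring_1) \<Rightarrow> ('n::finite \<Rightarrow> 'c) \<Rightarrow> ('k, 'n) coord_ring \<Rightarrow> 'c" where
  "evalp h g p = (\<Sum>m\<in>Poly_Mapping.keys p. h (Poly_Mapping.lookup p m) *
      (\<Prod>i\<in>UNIV. g i ^ Poly_Mapping.lookup m i))"

lemma evalp_superset:
  assumes "h 0 = 0" "finite M" "Poly_Mapping.keys p \<subseteq> M"
  shows "evalp h g p = (\<Sum>m\<in>M. h (Poly_Mapping.lookup p m) *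
      (\<Prod>i\<in>UNIV. g i ^ Poly_Mapping.lookup m i))"
  unfolding evalp_def using assms
  by (intro sum.mono_neutral_left) (auto simp: in_keys_iff)

lemma sum_single_lookup:
  "(\<Sum>m\<in>Poly_Mapping.keys p. Poly_Mapping.single m (Poly_Mapping.lookup p m)) = p"
  by (rule poly_mapping_eqI)
     (simp add: lookup_sum lookup_single when_def in_keys_iff)

lemma evalp_single:
  assumes "h 0 = 0"
  shows "evalp h g (Poly_Mapping.single m c) = h c * (\<Prod>i\<in>UNIV. g i ^ Poly_Mapping.lookup m i)"
  by (subst evalp_superset[where M = "{m}"]) (use assms in auto)

lemma evalp_unital_hom:
  fixes h :: "'k::field \<Rightarrow> 'c::comm_ring_1" and g :: "'n::finite \<Rightarrow> 'c"
  assumes "unital_hom h"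
  shows "unital_hom (evalp h g)"
proof -
  interpret h: unital_hom h by fact
  have add: "evalp h g (p + q) = evalp h g p + evalp h g q" for p q
    by (simp add: evalp_superset[where M = "Poly_Mapping.keys p \<union> Poly_Mapping.keys q"]
        keys_add lookup_add h.add distrib_right sum.distrib)
  have zero: "evalp h g 0 = 0" by (simp add: evalp_def)
  have sum: "evalp h g (sum u M) = (\<Sum>m\<in>M. evalp h g (u m))"
    for u and M :: "('n \<Rightarrow>\<^sub>0 nat) set"
    by (induction M rule: infinite_finite_induct) (auto simp: zero add)
  have single_mult: "evalp h g (Poly_Mapping.single m c * Poly_Mapping.single m' c')
      = evalp h g (Poly_Mapping.single m c) * evalp h g (Poly_Mapping.single m' c')" for m m' c c'
    by (simp add: mult_single evalp_single h.mult lookup_add power_add prod.distrib mult_ac)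
  show ?thesis
  proof
    show "evalp h g 1 = 1"
      using evalp_single[of h g 0 1] by simp
  next
    fix p q :: "('k, 'n) coord_ring"
    show "evalp h g (p + q) = evalp h g p + evalp h g q" by (rule add)
    let ?s = "\<lambda>p m. Poly_Mapping.single m (Poly_Mapping.lookup p m)"
    have "evalp h g (p * q) = evalp h g ((\<Sum>m\<in>Poly_Mapping.keys p. ?s p m) * (\<Sum>m\<in>Poly_Mapping.keys q. ?s q m))"
      by (simp only: sum_single_lookup)
    also have "\<dots> = (\<Sum>m\<in>Poly_Mapping.keys p. evalp h g (?s p m)) * (\<Sum>m\<in>Poly_Mapping.keys q. evalp h g (?s q m))"
      by (simp only: sum_product sum single_mult)
    also have "\<dots> = evalp h g p * evalp h g q"
      by (simp only: sum[symmetric] sum_single_lookup)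
    finally show "evalp h g (p * q) = evalp h g p * evalp h g q" .
  qed
qed

lemma const_unital_hom: "unital_hom (const :: 'k::field \<Rightarrow> ('k, 'n) coord_ring)"
  by unfold_locales (simp_all add: const_def single_add mult_single)

interpretation const: unital_hom "const :: 'k::field \<Rightarrow> ('k, 'n) coord_ring"
  by (rule const_unital_hom)

lemma evalp_const: "unital_hom h \<Longrightarrow> evalp h g (const c) = h c"
  by (simp add: const_def evalp_single unital_hom.zero)

lemma evalp_var: "unital_hom h \<Longrightarrow> evalp h g (var i) = g i"
  using prod.delta[of UNIV i "g", OF finite]
  by (simp add: var_def evalp_single unital_hom.zero unital_hom.one lookup_single when_def if_distrib
      cong: if_cong)

lemma single_eq_const_times_vars:
  "Poly_Mapping.single m c = const c * (\<Prod>i\<in>UNIV. var i ^ Poly_Mapping.lookup (m :: 'n::finite \<Rightarrow>\<^sub>0 nat) i)"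
proof -
  have power: "var i ^ e = Poly_Mapping.single (Poly_Mapping.single i e) 1" for i :: 'n and e
    by (induction e) (simp_all add: var_def mult_single single_add[symmetric])
  have prod: "(\<Prod>i\<in>I. Poly_Mapping.single (u i) 1) = Poly_Mapping.single (\<Sum>i\<in>I. u i) (1::'a)"
    for I and u :: "'n \<Rightarrow> 'n \<Rightarrow>\<^sub>0 nat"
    by (induction I rule: infinite_finite_induct) (simp_all add: mult_single)
  have "(\<Sum>i\<in>UNIV. Poly_Mapping.single i (Poly_Mapping.lookup m i)) = m"
    by (rule poly_mapping_eqI) (simp add: lookup_sum lookup_single when_def)
  then show ?thesis by (simp add: power prod const_def mult_single)
qed

lemma unital_hom_eq_evalp:
  fixes f :: "('k::field, 'n::finite) coord_ring \<Rightarrow> 'c::comm_ring_1"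
  assumes "unital_hom f"
  shows "f p = evalp (\<lambda>c. f (const c)) (\<lambda>i. f (var i)) p"
proof -
  interpret f: unital_hom f by fact
  have "f p = f (\<Sum>m\<in>Poly_Mapping.keys p. Poly_Mapping.single m (Poly_Mapping.lookup p m))"
    by (simp only: sum_single_lookup)
  also have "\<dots> = evalp (\<lambda>c. f (const c)) (\<lambda>i. f (var i)) p"
    by (simp add: f.sum evalp_def single_eq_const_times_vars f.mult f.prod f.power)
  finally show ?thesis .
qed

text \<open>Uniqueness in the universal property; later identities between homomorphisms are checked
  only on scalars and variables.\<close>

lemma coord_ring_hom_eqI:
  fixes f g :: "('k::field, 'n::finite) coord_ring \<Rightarrow> 'c::comm_ring_1"
  assumes "unital_hom f" "unital_hom g"
    and "\<And>c. f (const c) = g (const c)" "\<And>i. f (var i) = g (var i)"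
  shows "f p = g p"
  using unital_hom_eq_evalp[OF assms(1), of p] unital_hom_eq_evalp[OF assms(2), of p] assms(3,4)
  by simp

lemma poly_hom_eqI:
  assumes "unital_hom f" "unital_hom g"
    and "\<And>c. f [:c:] = g [:c:]" "f [:0, 1:] = g [:0, 1:]"
  shows "f p = g p"
proof (induction p)
  case 0
  show ?case using assms by (simp add: unital_hom.zero)
next
  case (pCons a p)
  interpret f: unital_hom f by fact
  interpret g: unital_hom g by fact
  have eq: "pCons a p = [:a:] + [:0, 1:] * p" by simp
  show ?case unfolding eq f.add f.mult g.add g.mult assms(3,4) pCons.IH ..
qed

text \<open>Leading monomials: in a linear order compatible with addition, the sum of the two
  largest monomials comes from one pair only, so its coefficient in the product is a product of two
  non-zero scalars.\<close>

lemma coord_ring_no_zero_divisors: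
  fixes p q :: "('k::field, 'n::finite) coord_ring"
  assumes "p * q = 0"
  shows "p = 0 \<or> q = 0"
proof (rule ccontr)
  assume "\<not> ?thesis"
  then have nz: "p \<noteq> 0" "q \<noteq> 0" by auto
  obtain e :: "'n \<Rightarrow> nat" where e: "inj e"
    using finite_imp_inj_to_nat_seg[of "UNIV :: 'n set"] by auto
  \<comment> \<open>The index type carries no order, so exponents are moved along an injection into
    the naturals, where finitely supported exponent functions are linearly ordered compatibly with
    addition.\<close>
  define w :: "('n \<Rightarrow>\<^sub>0 nat) \<Rightarrow> nat \<Rightarrow>\<^sub>0 nat"
    where "w m = (\<Sum>i\<in>UNIV. Poly_Mapping.single (e i) (Poly_Mapping.lookup m i))" for m
  have w_add: "w (m + m') = w m + w m'" for m m'
    by (simp add: w_def lookup_add single_add sum.distrib)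
  have "Poly_Mapping.lookup (w m) (e i) = Poly_Mapping.lookup m i" for m i
    using e by (simp add: w_def lookup_sum lookup_single when_def inj_eq)
  then have w_inj: "w m = w m' \<Longrightarrow> m = m'" for m m'
    by (metis poly_mapping_eqI)
  have max: "\<exists>M\<in>Poly_Mapping.keys r. \<forall>m\<in>Poly_Mapping.keys r. w m \<le> w M"
    if "r \<noteq> 0" for r :: "('k, 'n) coord_ring"
  proof -
    have "Max (w ` Poly_Mapping.keys r) \<in> w ` Poly_Mapping.keys r"
      using that by (intro Max_in) auto
    then obtain M where M: "M \<in> Poly_Mapping.keys r" "Max (w ` Poly_Mapping.keys r) = w M" by auto
    have "w m \<le> w M" if "m \<in> Poly_Mapping.keys r" for m
      unfolding M(2)[symmetric] using that by (intro Max_ge) auto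
    then show ?thesis using M(1) by blast
  qed
  obtain M where M: "M \<in> Poly_Mapping.keys p" "\<And>m. m \<in> Poly_Mapping.keys p \<Longrightarrow> w m \<le> w M"
    using max nz by blast
  obtain N where N: "N \<in> Poly_Mapping.keys q" "\<And>m. m \<in> Poly_Mapping.keys q \<Longrightarrow> w m \<le> w N"
    using max nz by blast
  have eq: "m = M \<and> m' = N" if "m \<in> Poly_Mapping.keys p" "m' \<in> Poly_Mapping.keys q" "m + m' = M + N" for m m'
  proof -
    have "w m + w m' = w M + w N" using that(3) by (metis w_add)
    moreover have "w m \<le> w M" "w m' \<le> w N" using M N that by auto
    ultimately have "w m = w M" "w m' = w N"
      by (metis add_le_cancel_left add_le_cancel_right add_right_mono antisym add_left_mono)+
    then show ?thesis using w_inj by blast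
  qed
  let ?s = "\<lambda>p m. Poly_Mapping.single m (Poly_Mapping.lookup p m)"
  have "p * q = (\<Sum>m\<in>Poly_Mapping.keys p. ?s p m) * (\<Sum>m\<in>Poly_Mapping.keys q. ?s q m)"
    by (simp only: sum_single_lookup)
  then have "Poly_Mapping.lookup (p * q) (M + N) =
      (\<Sum>m\<in>Poly_Mapping.keys p. \<Sum>m'\<in>Poly_Mapping.keys q.
        Poly_Mapping.lookup p m * Poly_Mapping.lookup q m' when m + m' = M + N)"
    by (simp add: sum_product mult_single lookup_sum lookup_single)
  also have "\<dots> = (\<Sum>m\<in>Poly_Mapping.keys p. \<Sum>m'\<in>Poly_Mapping.keys q.
        if m = M then (if m' = N then Poly_Mapping.lookup p M * Poly_Mapping.lookup q N else 0) else 0)"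
    by (intro sum.cong refl) (use eq in \<open>auto simp: when_def\<close>)
  also have "\<dots> = (\<Sum>m\<in>Poly_Mapping.keys p. if m = M then (\<Sum>m'\<in>Poly_Mapping.keys q.
        if m' = N then Poly_Mapping.lookup p M * Poly_Mapping.lookup q N else 0) else 0)"
    by (intro sum.cong refl) auto
  also have "\<dots> = Poly_Mapping.lookup p M * Poly_Mapping.lookup q N"
    using M(1) N(1) by simp
  also have "\<dots> \<noteq> 0" using M(1) N(1) by (simp add: in_keys_iff)
  finally show False using assms by simp
qed

lemma poly_coord_ring_no_zero_divisors:
  fixes p q :: "('k::field, 'n::finite) coord_ring poly"
  assumes "p * q = 0"
  shows "p = 0 \<or> q = 0"
proof -
  have "lead_coeff p * lead_coeff q = 0"
    using assms coeff_mult_degree_sum[of p q] by simp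
  then show ?thesis using coord_ring_no_zero_divisors by (metis leading_coeff_0_iff)
qed

section \<open>The matrix action on the coordinate ring\<close>

lemma act_eq_evalp:
  "act A = evalp const (\<lambda>i. \<Sum>j\<in>UNIV. const (matrix_inv A $ i $ j) * var j)"
  by (rule ext) (simp add: act_def subst_def evalp_def)

lemma act_unital_hom: "unital_hom (act A)"
  unfolding act_eq_evalp by (rule evalp_unital_hom[OF const_unital_hom])

lemma act_const [simp]: "act A (const c) = const c"
  by (simp add: act_eq_evalp evalp_const const_unital_hom)

lemma act_var: "act A (var i) = (\<Sum>j\<in>UNIV. const (matrix_inv A $ i $ j) * var j)"
  by (simp add: act_eq_evalp evalp_var const_unital_hom)

lemma matrix_inv_inverse:
  fixes A :: "'k::field^'n::finite^'n"
  assumes "invertible A"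
  shows "A ** matrix_inv A = mat 1" "matrix_inv A ** A = mat 1"
  using someI_ex[OF assms[unfolded invertible_def]] unfolding matrix_inv_def by blast+

lemma matrix_inv_eqI:
  fixes A B :: "'k::field^'n::finite^'n"
  assumes "A ** B = mat 1"
  shows "matrix_inv A = B"
proof -
  have "invertible A" using assms matrix_left_right_inverse[of A B] by (auto simp: invertible_def)
  then show ?thesis
    by (metis assms matrix_inv_inverse(2) matrix_mul_assoc matrix_mul_lid matrix_mul_rid)
qed

lemma act_mat_1 [simp]: "act (mat 1) p = p"
  for p :: "('k::field, 'n::finite) coord_ring"
proof (rule coord_ring_hom_eqI[OF act_unital_hom, of "\<lambda>p. p"])
  fix i :: 'n
  have "matrix_inv (mat 1 :: 'k^'n^'n) = mat 1" by (rule matrix_inv_eqI) simp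
  then show "act (mat 1) (var i :: ('k, 'n) coord_ring) = var i"
    by (simp add: act_var mat_def if_distrib if_distribR cong: if_cong)
qed (simp_all add: unital_hom_def)

text \<open>The inverse in \<open>act\<close> compensates the order reversal of pull-backs, which
  makes this a left action.\<close>

lemma act_act:
  assumes "invertible A" "invertible B"
  shows "act A (act B p) = act (A ** B) p"
proof (rule coord_ring_hom_eqI[OF unital_hom_comp[OF act_unital_hom act_unital_hom] act_unital_hom])
  fix i
  interpret A: unital_hom "act A" by (rule act_unital_hom)
  have "(A ** B) ** (matrix_inv B ** matrix_inv A) = A ** (B ** matrix_inv B) ** matrix_inv A"
    by (simp only: matrix_mul_assoc)
  then have "matrix_inv (A ** B) = matrix_inv B ** matrix_inv A"
    by (intro matrix_inv_eqI) (simp add: assms matrix_inv_inverse)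
  then have "act (A ** B) (var i) = (\<Sum>j\<in>UNIV. const (\<Sum>k\<in>UNIV. matrix_inv B $ i $ k * matrix_inv A $ k $ j) * var j)"
    by (simp add: act_var matrix_matrix_mult_def)
  also have "\<dots> = (\<Sum>j\<in>UNIV. \<Sum>k\<in>UNIV. const (matrix_inv B $ i $ k) * (const (matrix_inv A $ k $ j) * var j))"
    by (simp add: const.sum const.mult sum_distrib_right mult.assoc)
  also have "\<dots> = act A (act B (var i))"
    by (subst sum.swap) (simp add: act_var A.sum A.mult sum_distrib_left)
  finally show "act A (act B (var i)) = act (A ** B) (var i)" by simp
qed simp

section \<open>Grading\<close>

definition hom_comp :: "nat \<Rightarrow> ('k::field, 'n::finite) coord_ring \<Rightarrow> ('k, 'n) coord_ring" where
  "hom_comp d p = (\<Sum>m\<in>{m \<in> Poly_Mapping.keys p. mon_deg m = d}.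
      Poly_Mapping.single m (Poly_Mapping.lookup p m))"

lemma lookup_hom_comp:
  "Poly_Mapping.lookup (hom_comp d p) m = (Poly_Mapping.lookup p m when mon_deg m = d)"
  by (auto simp: hom_comp_def lookup_sum lookup_single when_def in_keys_iff)

lemma hom_comp_zero [simp]: "hom_comp d 0 = 0"
  by (simp add: hom_comp_def)

lemma hom_comp_add: "hom_comp d (p + q) = hom_comp d p + hom_comp d q"
  by (rule poly_mapping_eqI) (simp add: lookup_hom_comp lookup_add when_def)

lemma hom_comp_sum: "hom_comp d (sum u I) = (\<Sum>i\<in>I. hom_comp d (u i))"
  by (induction I rule: infinite_finite_induct) (auto simp: hom_comp_add)

lemma homogeneous_hom_comp: "homogeneous d (hom_comp d p)"
  by (auto simp: homogeneous_def in_keys_iff lookup_hom_comp when_def split: if_splits)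

lemma hom_comp_homogeneous:
  assumes "homogeneous e p"
  shows "hom_comp d p = (if d = e then p else 0)"
  using assms
  by (intro poly_mapping_eqI) (auto simp: homogeneous_def lookup_hom_comp when_def in_keys_iff)

lemma sum_hom_comp:
  assumes "finite D" "mon_deg ` Poly_Mapping.keys p \<subseteq> D"
  shows "(\<Sum>d\<in>D. hom_comp d p) = p"
proof (rule poly_mapping_eqI)
  fix m
  show "Poly_Mapping.lookup (\<Sum>d\<in>D. hom_comp d p) m = Poly_Mapping.lookup p m"
    using assms by (auto simp: lookup_sum lookup_hom_comp when_def in_keys_iff image_subset_iff)
qed

lemma homogeneous_zero: "homogeneous d 0"
  by (simp add: homogeneous_def)

lemma homogeneous_add: "homogeneous d p \<Longrightarrow> homogeneous d q \<Longrightarrow> homogeneous d (p + q)"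
  using keys_add[of p q] by (auto simp: homogeneous_def)

lemma homogeneous_sum:
  "(\<And>i. i \<in> I \<Longrightarrow> homogeneous d (u i)) \<Longrightarrow> homogeneous d (sum u I)"
  by (induction I rule: infinite_finite_induct) (auto simp: homogeneous_zero homogeneous_add)

lemma homogeneous_mult:
  assumes "homogeneous d p" "homogeneous e q"
  shows "homogeneous (d + e) (p * q)"
  unfolding homogeneous_def
proof
  fix m assume "m \<in> Poly_Mapping.keys (p * q)"
  then obtain a b where "a \<in> Poly_Mapping.keys p" "b \<in> Poly_Mapping.keys q" "m = a + b"
    using keys_mult[of p q] by auto
  then show "mon_deg m = d + e"
    using assms by (auto simp: homogeneous_def mon_deg_def lookup_add sum.distrib)
qed

lemma homogeneous_const: "homogeneous 0 (const c)"
  by (auto simp: homogeneous_def const_def mon_deg_def)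

lemma homogeneous_var: "homogeneous 1 (var i)"
  by (simp add: homogeneous_def var_def mon_deg_def lookup_single when_def)

lemma homogeneous_one: "homogeneous 0 1"
  using homogeneous_const[of 1] by simp

lemma homogeneous_power: "homogeneous d p \<Longrightarrow> homogeneous (n * d) (p ^ n)"
  by (induction n) (auto simp: homogeneous_one intro: homogeneous_mult)

lemma homogeneous_prod:
  "finite I \<Longrightarrow> (\<And>i. i \<in> I \<Longrightarrow> homogeneous (d i) (u i)) \<Longrightarrow> homogeneous (\<Sum>i\<in>I. d i) (\<Prod>i\<in>I. u i)"
  by (induction I rule: finite_induct) (auto simp: homogeneous_one intro: homogeneous_mult)

lemma homogeneous_act:
  assumes "homogeneous d p"
  shows "homogeneous d (act A p)"
  unfolding act_def subst_def
proof (rule homogeneous_sum)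
  fix m assume m: "m \<in> Poly_Mapping.keys p"
  define l where "l i = (\<Sum>j\<in>UNIV. const (matrix_inv A $ i $ j) * var j)" for i
  have "homogeneous (0 + 1) (l i)" for i
    unfolding l_def by (intro homogeneous_sum homogeneous_mult homogeneous_const homogeneous_var)
  then have "homogeneous (Poly_Mapping.lookup m i * 1) (l i ^ Poly_Mapping.lookup m i)" for i
    by (intro homogeneous_power) simp
  then have "homogeneous (\<Sum>i\<in>UNIV. Poly_Mapping.lookup m i * 1) (\<Prod>i\<in>UNIV. l i ^ Poly_Mapping.lookup m i)"
    by (intro homogeneous_prod) auto
  then have "homogeneous (mon_deg m) (\<Prod>i\<in>UNIV. l i ^ Poly_Mapping.lookup m i)"
    by (simp add: mon_deg_def)
  from homogeneous_mult[OF homogeneous_const this]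
  show "homogeneous d (const (Poly_Mapping.lookup p m) *
      (\<Prod>i\<in>UNIV. (\<Sum>j\<in>UNIV. const (matrix_inv A $ i $ j) * var j) ^ Poly_Mapping.lookup m i))"
    using assms m by (simp add: homogeneous_def l_def)
qed

lemma hom_comp_act: "hom_comp d (act A p) = act A (hom_comp d p)"
proof -
  interpret unital_hom "act A" by (rule act_unital_hom)
  \<comment> \<open>Inserting \<open>d\<close> lets the final sum pick out this index even when
    \<open>p\<close> has no monomial of degree \<open>d\<close>.\<close>
  let ?D = "insert d (mon_deg ` Poly_Mapping.keys p)"
  have "hom_comp d (act A p) = hom_comp d (act A (\<Sum>e\<in>?D. hom_comp e p))"
    by (subst sum_hom_comp) auto
  also have "\<dots> = (\<Sum>e\<in>?D. hom_comp d (act A (hom_comp e p)))"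
    by (simp only: sum hom_comp_sum)
  also have "\<dots> = (\<Sum>e\<in>?D. if d = e then act A (hom_comp d p) else 0)"
    by (intro sum.cong refl)
       (auto simp: hom_comp_homogeneous[OF homogeneous_act[OF homogeneous_hom_comp]])
  also have "\<dots> = act A (hom_comp d p)" by (simp add: sum.delta')
  finally show ?thesis .
qed

lemma hom_comp_mult_homogeneous:
  assumes "homogeneous e a"
  shows "hom_comp (e + d) (a * p) = a * hom_comp d p"
proof -
  let ?D = "insert d (mon_deg ` Poly_Mapping.keys p)"
  have "hom_comp (e + d) (a * p) = hom_comp (e + d) (a * (\<Sum>f\<in>?D. hom_comp f p))"
    by (subst sum_hom_comp) auto
  also have "\<dots> = (\<Sum>f\<in>?D. hom_comp (e + d) (a * hom_comp f p))"
    by (simp only: sum_distrib_left hom_comp_sum)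
  also have "\<dots> = (\<Sum>f\<in>?D. if d = f then a * hom_comp d p else 0)"
    by (intro sum.cong refl)
       (auto simp: hom_comp_homogeneous[OF homogeneous_mult[OF assms homogeneous_hom_comp]])
  also have "\<dots> = a * hom_comp d p" by (simp add: sum.delta')
  finally show ?thesis .
qed

section \<open>Graded pieces of invariants and a criterion for direct summands\<close>

lemma invariants_mult: "p \<in> invariants G \<Longrightarrow> q \<in> invariants G \<Longrightarrow> p * q \<in> invariants G"
  by (simp add: invariants_def unital_hom.mult[OF act_unital_hom])

lemma invariants_sum: "(\<And>i. i \<in> I \<Longrightarrow> u i \<in> invariants G) \<Longrightarrow> sum u I \<in> invariants G"
  by (simp add: invariants_def unital_hom.sum[OF act_unital_hom])

lemma invariants_const: "const c \<in> invariants G"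
  by (simp add: invariants_def)

lemma invariants_hom_comp: "p \<in> invariants G \<Longrightarrow> hom_comp d p \<in> invariants G"
  by (simp add: invariants_def hom_comp_act[symmetric])

lemma mon_deg_eq_0_iff: "mon_deg m = 0 \<longleftrightarrow> m = 0"
  by (auto simp: mon_deg_def intro: poly_mapping_eqI)

text \<open>Only the degree-preserving part of \<open>\<phi>\<close> matters: it sends 1 to a non-zero constant.\<close>

lemma direct_summand_propertyI:
  fixes H :: "('k::field^'n::finite^'n) set"
  assumes add: "\<And>x y. \<phi> (x + y) = \<phi> x + \<phi> y"
    and mult: "\<And>a x. a \<in> invariants H \<Longrightarrow> \<phi> (a * x) = a * \<phi> x"
    and inv: "\<And>x. \<phi> x \<in> invariants H"
    and one: "Poly_Mapping.lookup (\<phi> 1) 0 \<noteq> 0"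
  shows "direct_summand_property H"
proof -
  have \<phi>0: "\<phi> 0 = 0" using add[of 0 0] by simp
  define \<psi> where "\<psi> x = (\<Sum>d\<in>mon_deg ` Poly_Mapping.keys x. hom_comp d (\<phi> (hom_comp d x)))" for x
  \<comment> \<open>Read off coefficientwise, \<open>\<psi>\<close> no longer refers to the set of
    degrees occurring in \<open>x\<close>, so additivity passes over from
    \<open>\<phi>\<close>.\<close>
  have lookup_\<psi>: "Poly_Mapping.lookup (\<psi> x) m = Poly_Mapping.lookup (\<phi> (hom_comp (mon_deg m) x)) m" for x m
  proof (cases "mon_deg m \<in> mon_deg ` Poly_Mapping.keys x")
    case True
    then show ?thesis by (simp add: \<psi>_def lookup_sum lookup_hom_comp when_def)
  next
    case False
    then have "hom_comp (mon_deg m) x = 0"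
      by (intro poly_mapping_eqI)
         (simp add: lookup_hom_comp when_def, metis imageI in_keys_iff)
    then show ?thesis using False by (simp add: \<psi>_def lookup_sum lookup_hom_comp when_def \<phi>0)
  qed
  have \<psi>_add: "\<psi> (x + y) = \<psi> x + \<psi> y" for x y
    by (rule poly_mapping_eqI) (simp add: lookup_\<psi> lookup_add hom_comp_add add)
  have \<psi>_zero: "\<psi> 0 = 0" using \<psi>_add[of 0 0] by simp
  have \<psi>_sum: "\<psi> (sum u D) = (\<Sum>d\<in>D. \<psi> (u d))" for u and D :: "nat set"
    by (induction D rule: infinite_finite_induct) (auto simp: \<psi>_add \<psi>_zero)
  have \<psi>_hom: "\<psi> x = hom_comp d (\<phi> x)" if "homogeneous d x" for d x
    by (rule poly_mapping_eqI)
       (simp add: lookup_\<psi> hom_comp_homogeneous[OF that] lookup_hom_comp when_def \<phi>0)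
  have \<psi>_inv: "\<psi> x \<in> invariants H" for x
    unfolding \<psi>_def by (intro invariants_sum invariants_hom_comp inv)
  have \<psi>_mult_hom: "\<psi> (a * x) = a * \<psi> x"
    if "a \<in> invariants H" "homogeneous e a" "homogeneous d x" for a x d e
    using that by (simp add: \<psi>_hom[OF homogeneous_mult] \<psi>_hom mult hom_comp_mult_homogeneous)
  have \<psi>_mult: "\<psi> (a * x) = a * \<psi> x" if a: "a \<in> invariants H" for a x
  proof -
    let ?D = "mon_deg ` Poly_Mapping.keys a" and ?E = "mon_deg ` Poly_Mapping.keys x"
    have "\<psi> (a * x) = \<psi> ((\<Sum>d\<in>?D. hom_comp d a) * (\<Sum>e\<in>?E. hom_comp e x))"
      by (simp add: sum_hom_comp)
    also have "\<dots> = (\<Sum>d\<in>?D. \<Sum>e\<in>?E. \<psi> (hom_comp d a * hom_comp e x))"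
      by (simp only: sum_product \<psi>_sum)
    also have "\<dots> = (\<Sum>d\<in>?D. \<Sum>e\<in>?E. hom_comp d a * \<psi> (hom_comp e x))"
      by (simp only: \<psi>_mult_hom[OF invariants_hom_comp[OF a] homogeneous_hom_comp homogeneous_hom_comp])
    also have "\<dots> = (\<Sum>d\<in>?D. hom_comp d a) * \<psi> (\<Sum>e\<in>?E. hom_comp e x)"
      by (simp only: sum_product \<psi>_sum)
    also have "\<dots> = a * \<psi> x" by (simp add: sum_hom_comp)
    finally show ?thesis .
  qed
  define c where "c = Poly_Mapping.lookup (\<phi> 1) 0"
  \<comment> \<open>The degree-zero part of \<open>\<phi> 1\<close> is a scalar, and it is
    invertible by the assumption \<open>one\<close>.\<close>
  have "\<psi> 1 = const c"
    unfolding \<psi>_hom[OF homogeneous_one]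
    by (rule poly_mapping_eqI)
       (auto simp: lookup_hom_comp mon_deg_eq_0_iff const_def lookup_single when_def c_def)
  then have \<psi>_one: "const (inverse c) * \<psi> 1 = 1"
    using one by (simp add: c_def const.mult[symmetric])
  define \<pi> where "\<pi> x = const (inverse c) * \<psi> x" for x
  have \<pi>_mult: "\<pi> (a * x) = a * \<pi> x" if "a \<in> invariants H" for a x
    by (simp add: \<pi>_def \<psi>_mult[OF that] mult_ac)
  have "a \<in> range \<pi>" if "a \<in> invariants H" for a
    using \<pi>_mult[OF that, of 1] \<psi>_one by (metis \<pi>_def mult.right_neutral rangeI)
  moreover have "\<pi> x \<in> invariants H" for x
    unfolding \<pi>_def by (intro invariants_mult invariants_const \<psi>_inv)
  ultimately have "range \<pi> = invariants H" by blast
  moreover have "homogeneous d (\<pi> x)" if "homogeneous d x" for d x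
    using homogeneous_mult[OF homogeneous_const homogeneous_hom_comp[of d "\<phi> x"]]
    by (simp add: \<pi>_def \<psi>_hom[OF that])
  moreover have "\<pi> (x + y) = \<pi> x + \<pi> y" for x y
    by (simp add: \<pi>_def \<psi>_add distrib_left)
  ultimately show ?thesis
    unfolding direct_summand_property_def using \<pi>_mult by blast
qed

section \<open>Translation and evaluation at a point over k[T]\<close>

text \<open>The extension of \<open>\<theta>\<close> that fixes the variable T:
  \<open>map_poly\<close> produces a polynomial whose coefficients are polynomials in T, and its
  outer variable is then set to T, written \<open>[:0, 1:]\<close>.\<close>

definition extp :: "('a::comm_ring_1 \<Rightarrow> 'b::comm_ring_1 poly) \<Rightarrow> 'a poly \<Rightarrow> 'b poly" where
  "extp \<theta> p = poly (map_poly \<theta> p) [:0, 1:]"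

lemma extp_unital_hom: "unital_hom \<theta> \<Longrightarrow> unital_hom (extp \<theta>)"
  unfolding extp_def
  by (rule unital_hom_comp[OF unital_hom_poly unital_hom.map_poly_unital_hom])

lemma extp_const [simp]: "unital_hom \<theta> \<Longrightarrow> extp \<theta> [:c:] = \<theta> c"
  by (simp add: extp_def unital_hom.map_poly_pCons)

lemma extp_X [simp]: "unital_hom \<theta> \<Longrightarrow> extp \<theta> [:0, 1:] = [:0, 1:]"
  by (simp add: extp_def unital_hom.map_poly_pCons unital_hom.zero unital_hom.one)

text \<open>The constant term is evaluation at the origin, with \<open>0 ^ 0 = 1\<close>.\<close>

lemma lookup_0_unital_hom:
  "unital_hom (\<lambda>p :: ('k::field, 'n::finite) coord_ring. Poly_Mapping.lookup p 0)"
proof -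
  have "Poly_Mapping.lookup p 0 = evalp (\<lambda>c. c) (\<lambda>_. 0) p" for p :: "('k, 'n) coord_ring"
  proof -
    have "(\<Prod>i\<in>UNIV. 0 ^ Poly_Mapping.lookup m i) = (if m = 0 then 1 else (0::'k))"
      for m :: "'n \<Rightarrow>\<^sub>0 nat"
    proof (cases "m = 0")
      case False
      then obtain i where "Poly_Mapping.lookup m i \<noteq> 0" by (metis lookup_zero poly_mapping_eqI)
      then show ?thesis using False by (auto intro!: bexI[of _ i])
    qed simp
    then have "evalp (\<lambda>c. c) (\<lambda>_. 0) p =
        (\<Sum>m\<in>Poly_Mapping.keys p. if m = 0 then Poly_Mapping.lookup p m else 0)"
      unfolding evalp_def by (intro sum.cong refl) (simp only: mult_1_right mult_zero_right split: if_split, simp)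
    then show ?thesis by (simp add: in_keys_iff)
  qed
  moreover have "unital_hom (evalp (\<lambda>c. c) (\<lambda>_. 0) :: ('k, 'n) coord_ring \<Rightarrow> 'k)"
    by (rule evalp_unital_hom) (simp add: unital_hom_def)
  ultimately show ?thesis by presburger
qed

lemma lookup_const_0 [simp]: "Poly_Mapping.lookup (const c) 0 = c"
  by (simp add: const_def)

lemma lift_const_unital_hom: "unital_hom (\<lambda>c. [:const c:])"
  by (rule unital_hom_comp[OF unital_hom_const_poly const_unital_hom])

text \<open>The pull-back along the translation \<open>v \<mapsto> v + \<gamma>(T)\<close>.\<close>

definition translate ::
  "('n::finite \<Rightarrow> 'k::field poly) \<Rightarrow> ('k, 'n) coord_ring \<Rightarrow> ('k, 'n) coord_ring poly" where
  "translate \<gamma> = evalp (\<lambda>c. [:const c:]) (\<lambda>i. [:var i:] + map_poly const (\<gamma> i))"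

lemma translate_unital_hom: "unital_hom (translate \<gamma>)"
  unfolding translate_def by (rule evalp_unital_hom[OF lift_const_unital_hom])

lemma translate_const [simp]: "translate \<gamma> (const c) = [:const c:]"
  by (simp add: translate_def evalp_const[OF lift_const_unital_hom])

lemma translate_var: "translate \<gamma> (var i) = [:var i:] + map_poly const (\<gamma> i)"
  by (simp add: translate_def evalp_var[OF lift_const_unital_hom])

lemma extp_map_const:
  assumes "unital_hom \<theta>" "\<And>c. \<theta> (const c) = [:h c:]" "unital_hom h"
  shows "extp \<theta> (map_poly const a) = map_poly h a"
proof (rule poly_hom_eqI[of "\<lambda>a. extp \<theta> (map_poly const a)" "map_poly h"])
  show "unital_hom (\<lambda>a. extp \<theta> (map_poly const a))"
    by (rule unital_hom_comp[OF extp_unital_hom[OF assms(1)] const.map_poly_unital_hom])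
  show "unital_hom (map_poly h)" using assms by (intro unital_hom.map_poly_unital_hom)
qed (simp_all add: assms unital_hom.map_poly_pCons unital_hom.zero unital_hom.one)

text \<open>The translations cancel because extending \<open>translate \<gamma>\<close> leaves the
  scalar polynomials \<open>\<gamma> i\<close> unchanged. This later makes the conjugated map linear
  over the original invariants.\<close>

lemma translate_translate_uminus:
  fixes \<gamma> :: "'n::finite \<Rightarrow> 'k::field poly"
  shows "extp (translate \<gamma>) (translate (\<lambda>i. - \<gamma> i) p) = [:p:]"
proof (rule coord_ring_hom_eqI[of "\<lambda>p. extp (translate \<gamma>) (translate (\<lambda>i. - \<gamma> i) p)" "\<lambda>p. [:p:]"])
  interpret t: unital_hom "extp (translate \<gamma>)"
    by (intro extp_unital_hom translate_unital_hom)
  interpret c: unital_hom "map_poly (const :: 'k \<Rightarrow> ('k, 'n) coord_ring)"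
    by (rule const.map_poly_unital_hom)
  show "unital_hom (\<lambda>p. extp (translate \<gamma>) (translate (\<lambda>i. - \<gamma> i) p))"
    by (rule unital_hom_comp[OF extp_unital_hom[OF translate_unital_hom] translate_unital_hom])
  show "unital_hom (\<lambda>p :: ('k, 'n) coord_ring. [:p:])" by (rule unital_hom_const_poly)
  fix i
  show "extp (translate \<gamma>) (translate (\<lambda>i. - \<gamma> i) (var i)) = [:var i:]"
    by (simp add: translate_var t.add t.diff t.uminus c.uminus translate_unital_hom
        extp_map_const[where h = const] const_unital_hom)
qed (simp add: translate_unital_hom)

text \<open>Since \<open>matrix_inv A\<close> fixes \<open>\<gamma>\<close>, applying it before or
  after adding \<open>\<gamma>\<close> gives the same point.\<close>

lemma translate_act:
  fixes \<gamma> :: "'n::finite \<Rightarrow> 'k::field poly" and A :: "'k^'n^'n"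
  assumes "\<And>i. (\<Sum>j\<in>UNIV. [:matrix_inv A $ i $ j:] * \<gamma> j) = \<gamma> i"
  shows "translate \<gamma> (act A p) = map_poly (act A) (translate \<gamma> p)"
proof (rule coord_ring_hom_eqI[of "\<lambda>p. translate \<gamma> (act A p)" "\<lambda>p. map_poly (act A) (translate \<gamma> p)"])
  interpret t: unital_hom "translate \<gamma>" by (rule translate_unital_hom)
  interpret a: unital_hom "act A" by (rule act_unital_hom)
  interpret ma: unital_hom "map_poly (act A)" by (rule a.map_poly_unital_hom)
  interpret c: unital_hom "map_poly (const :: 'k \<Rightarrow> ('k, 'n) coord_ring)"
    by (rule const.map_poly_unital_hom)
  interpret l: unital_hom "\<lambda>c :: ('k, 'n) coord_ring. [:c:]" by (rule unital_hom_const_poly)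
  show "unital_hom (\<lambda>p. translate \<gamma> (act A p))"
    by (rule unital_hom_comp[OF translate_unital_hom act_unital_hom])
  show "unital_hom (\<lambda>p. map_poly (act A) (translate \<gamma> p))"
    by (rule unital_hom_comp[OF a.map_poly_unital_hom translate_unital_hom])
  fix i
  have fix_const: "map_poly (act A) (map_poly const q) = map_poly const q" for q
    by (simp add: map_poly_map_poly o_def)
  have "translate \<gamma> (act A (var i)) =
      (\<Sum>j\<in>UNIV. [:const (matrix_inv A $ i $ j):] * ([:var j:] + map_poly const (\<gamma> j)))"
    by (simp add: act_var t.sum t.mult translate_var)
  also have "\<dots> = [:act A (var i):] + map_poly const (\<Sum>j\<in>UNIV. [:matrix_inv A $ i $ j:] * \<gamma> j)"
    by (simp only: distrib_left sum.distrib act_var l.sum l.mult c.sum c.mult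
        const.map_poly_pCons map_poly_0)
  also have "\<dots> = map_poly (act A) (translate \<gamma> (var i))"
    unfolding assms by (simp add: translate_var ma.add fix_const)
  finally show "translate \<gamma> (act A (var i)) = map_poly (act A) (translate \<gamma> (var i))" .
qed (simp add: unital_hom.map_poly_pCons[OF act_unital_hom])

text \<open>Both maps fix T, so the commutation extends from k[V] to k[V][T].\<close>

lemma extp_translate_act:
  fixes \<gamma> :: "'n::finite \<Rightarrow> 'k::field poly" and A :: "'k^'n^'n"
  assumes "\<And>i. (\<Sum>j\<in>UNIV. [:matrix_inv A $ i $ j:] * \<gamma> j) = \<gamma> i"
  shows "extp (translate \<gamma>) (map_poly (act A) p) = map_poly (act A) (extp (translate \<gamma>) p)"
proof (rule poly_hom_eqI[of "\<lambda>p. extp (translate \<gamma>) (map_poly (act A) p)"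
      "\<lambda>p. map_poly (act A) (extp (translate \<gamma>) p)"])
  interpret a: unital_hom "act A" by (rule act_unital_hom)
  show "unital_hom (\<lambda>p. extp (translate \<gamma>) (map_poly (act A) p))"
    by (rule unital_hom_comp[OF extp_unital_hom[OF translate_unital_hom] a.map_poly_unital_hom])
  show "unital_hom (\<lambda>p. map_poly (act A) (extp (translate \<gamma>) p))"
    by (rule unital_hom_comp[OF a.map_poly_unital_hom extp_unital_hom[OF translate_unital_hom]])
  show "extp (translate \<gamma>) (map_poly (act A) [:c:]) = map_poly (act A) (extp (translate \<gamma>) [:c:])" for c
    by (simp add: translate_unital_hom translate_act[OF assms])
  show "extp (translate \<gamma>) (map_poly (act A) [:0, 1:]) = map_poly (act A) (extp (translate \<gamma>) [:0, 1:])"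
    by (simp add: translate_unital_hom)
qed

section \<open>Evaluation at a polynomial point\<close>

definition eval_at :: "('n::finite \<Rightarrow> 'k::field poly) \<Rightarrow> ('k, 'n) coord_ring \<Rightarrow> 'k poly" where
  "eval_at \<gamma> = evalp (\<lambda>c. [:c:]) \<gamma>"

lemma eval_at_unital_hom: "unital_hom (eval_at \<gamma>)"
  unfolding eval_at_def by (rule evalp_unital_hom[OF unital_hom_const_poly])

lemma eval_at_const [simp]: "eval_at \<gamma> (const c) = [:c:]"
  by (simp add: eval_at_def evalp_const[OF unital_hom_const_poly])

lemma eval_at_var [simp]: "eval_at \<gamma> (var i) = \<gamma> i"
  by (simp add: eval_at_def evalp_var[OF unital_hom_const_poly])

text \<open>Translating by \<open>\<gamma>\<close> and then setting all coordinates to zero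
  evaluates at \<open>\<gamma>\<close>. This turns a non-zero value into a non-zero constant
  term.\<close>

lemma constant_term_translate:
  fixes \<gamma> :: "'n::finite \<Rightarrow> 'k::field poly"
  shows "map_poly (\<lambda>p. Poly_Mapping.lookup p 0) (extp (translate \<gamma>) q) = extp (eval_at \<gamma>) q"
proof (rule poly_hom_eqI[of "\<lambda>q. map_poly (\<lambda>p. Poly_Mapping.lookup p 0) (extp (translate \<gamma>) q)"
      "extp (eval_at \<gamma>)"])
  interpret l: unital_hom "\<lambda>p :: ('k, 'n) coord_ring. Poly_Mapping.lookup p 0"
    by (rule lookup_0_unital_hom)
  interpret ml: unital_hom "map_poly (\<lambda>p :: ('k, 'n) coord_ring. Poly_Mapping.lookup p 0)"
    by (rule l.map_poly_unital_hom)
  show "unital_hom (\<lambda>q. map_poly (\<lambda>p. Poly_Mapping.lookup p 0) (extp (translate \<gamma>) q))"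
    by (rule unital_hom_comp[OF l.map_poly_unital_hom extp_unital_hom[OF translate_unital_hom]])
  show "unital_hom (extp (eval_at \<gamma>))"
    by (intro extp_unital_hom eval_at_unital_hom)
  have "map_poly (\<lambda>p. Poly_Mapping.lookup p 0) (translate \<gamma> p) = eval_at \<gamma> p" for p
  proof (rule coord_ring_hom_eqI[of "\<lambda>p. map_poly (\<lambda>p. Poly_Mapping.lookup p 0) (translate \<gamma> p)"
        "eval_at \<gamma>"])
    show "unital_hom (\<lambda>p. map_poly (\<lambda>p. Poly_Mapping.lookup p 0) (translate \<gamma> p))"
      by (rule unital_hom_comp[OF l.map_poly_unital_hom translate_unital_hom])
    show "unital_hom (eval_at \<gamma>)" by (rule eval_at_unital_hom)
    fix i
    have "Poly_Mapping.lookup (var i :: ('k, 'n) coord_ring) 0 = 0"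
      by (simp add: var_def lookup_single when_def) (metis lookup_single_eq lookup_zero nat.distinct(1))
    then show "map_poly (\<lambda>p. Poly_Mapping.lookup p 0) (translate \<gamma> (var i)) = eval_at \<gamma> (var i)"
      by (simp add: translate_var ml.add map_poly_map_poly o_def)
  qed simp
  then show "map_poly (\<lambda>p. Poly_Mapping.lookup p 0) (extp (translate \<gamma>) [:c:]) = extp (eval_at \<gamma>) [:c:]" for c
    by (simp add: translate_unital_hom eval_at_unital_hom)
qed (simp add: translate_unital_hom eval_at_unital_hom unital_hom.map_poly_pCons[OF lookup_0_unital_hom])

lemma eval_at_act_var:
  "eval_at \<gamma> (act A (var i)) = (\<Sum>j\<in>UNIV. [:matrix_inv A $ i $ j:] * \<gamma> j)"
proof -
  interpret e: unital_hom "eval_at \<gamma>" by (rule eval_at_unital_hom)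
  show ?thesis by (simp only: act_var e.sum e.mult eval_at_const eval_at_var)
qed

lemma eval_at_act:
  fixes \<gamma> :: "'n::finite \<Rightarrow> 'k::field poly" and A :: "'k^'n^'n"
  assumes "\<And>i. (\<Sum>j\<in>UNIV. [:matrix_inv A $ i $ j:] * \<gamma> j) = \<gamma> i"
  shows "eval_at \<gamma> (act A p) = eval_at \<gamma> p"
proof (rule coord_ring_hom_eqI[of "\<lambda>p. eval_at \<gamma> (act A p)" "eval_at \<gamma>"])
  show "unital_hom (\<lambda>p. eval_at \<gamma> (act A p))"
    by (rule unital_hom_comp[OF eval_at_unital_hom act_unital_hom])
  show "unital_hom (eval_at \<gamma>)" by (rule eval_at_unital_hom)
qed (simp_all only: eval_at_act_var assms act_const eval_at_var)

section \<open>Point-stabilizers\<close>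

text \<open>Each element of \<open>G\<close> outside the stabilizer moves some vector of
  \<open>U\<close>. Using one such vector as the coefficient of each power of T gives a point with
  all coefficient vectors in \<open>U\<close>; a matrix over \<open>k\<close> acts on these
  separately, so it fixes the point only if it fixes each of them.\<close>

lemma exists_generic_point:
  fixes G :: "('k::field^'n::finite^'n) set"
  assumes "finite G"
  shows "\<exists>\<gamma> :: 'n \<Rightarrow> 'k poly. \<forall>A\<in>G.
      A \<in> point_stabilizer G U \<longleftrightarrow> (\<forall>i. (\<Sum>j\<in>UNIV. [:A $ i $ j:] * \<gamma> j) = \<gamma> i)"
proof -
  let ?M = "G - point_stabilizer G U"
  have "\<forall>A\<in>?M. \<exists>u. u \<in> U \<and> A *v u \<noteq> u" by (auto simp: point_stabilizer_def)
  from bchoice[OF this] obtain u where u: "\<And>A. A \<in> ?M \<Longrightarrow> u A \<in> U" "\<And>A. A \<in> ?M \<Longrightarrow> A *v u A \<noteq> u A"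
    by blast
  \<comment> \<open>The enumeration gives the chosen vectors distinct exponents, so they cannot
    interfere.\<close>
  obtain e where e: "bij_betw e {0..<card ?M} ?M"
    using ex_bij_betw_nat_finite[of ?M] assms by blast
  define w where "w l = u (e l)" for l
  define \<gamma> where "\<gamma> i = (\<Sum>l<card ?M. monom (w l $ i) l)" for i
  have A\<gamma>: "(\<Sum>j\<in>UNIV. [:A $ i $ j:] * \<gamma> j) = (\<Sum>l<card ?M. monom ((A *v w l) $ i) l)" for A i
  proof -
    have "(\<Sum>j\<in>UNIV. [:A $ i $ j:] * \<gamma> j) = (\<Sum>j\<in>UNIV. \<Sum>l<card ?M. monom (A $ i $ j * w l $ j) l)"
      by (intro sum.cong refl poly_eqI) (simp add: \<gamma>_def coeff_sum)
    also have "\<dots> = (\<Sum>l<card ?M. monom ((A *v w l) $ i) l)"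
      by (subst sum.swap, intro sum.cong refl poly_eqI)
         (simp add: matrix_vector_mult_def coeff_sum)
    finally show ?thesis .
  qed
  have coeff: "coeff (\<Sum>l<card ?M. monom (v l) l) l = v l" if "l < card ?M" for l and v :: "nat \<Rightarrow> 'k"
    using that by (simp add: coeff_sum)
  show ?thesis
  proof (intro exI[of _ \<gamma>] ballI iffI)
    fix A assume "A \<in> point_stabilizer G U"
    moreover have "w l \<in> U" if "l < card ?M" for l
      using u(1) bij_betwE[OF e] that by (simp add: w_def)
    ultimately have "A *v w l = w l" if "l < card ?M" for l
      using that by (simp add: point_stabilizer_def)
    then show "\<forall>i. (\<Sum>j\<in>UNIV. [:A $ i $ j:] * \<gamma> j) = \<gamma> i"
      unfolding A\<gamma> by (simp add: \<gamma>_def)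
  next
    fix A assume A: "A \<in> G" "\<forall>i. (\<Sum>j\<in>UNIV. [:A $ i $ j:] * \<gamma> j) = \<gamma> i"
    show "A \<in> point_stabilizer G U"
    proof (rule ccontr)
      assume "A \<notin> point_stabilizer G U"
      then have M: "A \<in> ?M" using A by blast
      then have "A \<in> e ` {0..<card ?M}" unfolding bij_betw_imp_surj_on[OF e] .
      then obtain l where l: "l < card ?M" "e l = A" by auto
      have "(A *v w l) $ i = w l $ i" for i
        using A(2)[unfolded A\<gamma>] coeff[OF l(1), of "\<lambda>l. (A *v w l) $ i"] coeff[OF l(1), of "\<lambda>l. w l $ i"]
        by (simp add: \<gamma>_def)
      then have "A *v w l = w l" by (simp add: vec_eq_iff)
      then show False using u(2)[OF M] l by (simp add: w_def)
    qed
  qed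
qed

lemma finite_matrix_group_point_stabilizer:
  assumes "finite_matrix_group G"
  shows "finite_matrix_group (point_stabilizer G U)"
proof -
  have "matrix_inv A *v u = u" if "invertible A" "A *v u = u" for A :: "'a^'b^'b" and u
    using that matrix_inv_inverse(2)
    by (metis matrix_vector_mul_assoc matrix_vector_mul_lid)
  then show ?thesis
    using assms unfolding finite_matrix_group_def point_stabilizer_def
    by (auto simp flip: matrix_vector_mul_assoc)
qed

section \<open>The coefficientwise action on k[V][T]\<close>

definition coeff_action ::
  "('k::field^'n::finite^'n) \<Rightarrow> ('k, 'n) coord_ring poly \<Rightarrow> ('k, 'n) coord_ring poly" where
  "coeff_action A = map_poly (act A)"

lemma fixed_by_coeff_action:
  "p \<in> fixed_by (coeff_action ` G) \<longleftrightarrow> (\<forall>i. coeff p i \<in> invariants G)"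
proof -
  have "coeff_action A p = p \<longleftrightarrow> (\<forall>i. act A (coeff p i) = coeff p i)" for A
    by (simp add: coeff_action_def poly_eq_iff coeff_map_poly unital_hom.zero[OF act_unital_hom])
  then show ?thesis by (auto simp: fixed_by_def invariants_def)
qed

lemma coeff_action_comp:
  assumes "invertible A" "invertible B"
  shows "coeff_action A \<circ> coeff_action B = coeff_action (A ** B)"
  using assms
  by (intro ext) (simp add: coeff_action_def map_poly_map_poly o_def act_act unital_hom.zero[OF act_unital_hom])

lemma coeff_action_mat_1: "coeff_action (mat 1) = id"
  by (rule ext) (simp add: coeff_action_def map_poly_idI)

lemma coeff_action_group:
  assumes "finite_matrix_group G"
  shows "id \<in> coeff_action ` G"
    and "f \<in> coeff_action ` G \<Longrightarrow> g \<in> coeff_action ` G \<Longrightarrow> f \<circ> g \<in> coeff_action ` G"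
    and "f \<in> coeff_action ` G \<Longrightarrow> \<exists>g\<in>coeff_action ` G. g \<circ> f = id \<and> f \<circ> g = id"
proof -
  have G: "mat 1 \<in> G" "\<And>A B. A \<in> G \<Longrightarrow> B \<in> G \<Longrightarrow> A ** B \<in> G"
    "\<And>A. A \<in> G \<Longrightarrow> invertible A" "\<And>A. A \<in> G \<Longrightarrow> matrix_inv A \<in> G"
    using assms by (auto simp: finite_matrix_group_def)
  show "id \<in> coeff_action ` G" using G(1) coeff_action_mat_1 by (metis imageI)
  show "f \<circ> g \<in> coeff_action ` G" if "f \<in> coeff_action ` G" "g \<in> coeff_action ` G"
    using that G by (auto simp: coeff_action_comp)
  assume "f \<in> coeff_action ` G"
  then obtain A where A: "A \<in> G" "f = coeff_action A" by blast
  then show "\<exists>g\<in>coeff_action ` G. g \<circ> f = id \<and> f \<circ> g = id"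
    using G by (intro bexI[of _ "coeff_action (matrix_inv A)"])
      (auto simp: coeff_action_comp matrix_inv_inverse coeff_action_mat_1)
qed

section \<open>Descent of the direct summand property to the stabilizer\<close>

theorem theorem1:
  fixes G :: "('k::field^'n::finite^'n) set" and U :: "('k^'n) set"
  assumes "finite_matrix_group G"
    and "vec.subspace U"
    and "direct_summand_property G"
  shows "direct_summand_property (point_stabilizer G U)"
proof -
  define H where "H = point_stabilizer G U"
  have grp_H: "finite_matrix_group H"
    unfolding H_def by (rule finite_matrix_group_point_stabilizer[OF assms(1)])
  have HG: "H \<subseteq> G" by (auto simp: H_def point_stabilizer_def)
  have invG: "invertible A" "matrix_inv A \<in> G" if "A \<in> G" for A
    using assms(1) that by (auto simp: finite_matrix_group_def)
  have invH: "matrix_inv A \<in> H" if "A \<in> H" for A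
    using grp_H that by (auto simp: finite_matrix_group_def)
  have inv_inv: "matrix_inv (matrix_inv A) = A" if "A \<in> G" for A
    using invG[OF that] by (intro matrix_inv_eqI matrix_inv_inverse)
  obtain \<gamma> :: "'n \<Rightarrow> 'k poly" where
    \<gamma>0: "\<And>A. A \<in> G \<Longrightarrow> A \<in> H \<longleftrightarrow> (\<forall>i. (\<Sum>j\<in>UNIV. [:A $ i $ j:] * \<gamma> j) = \<gamma> i)"
    using exists_generic_point[of G U] assms(1) unfolding H_def finite_matrix_group_def by blast
  \<comment> \<open>\<open>act A\<close> pulls back along \<open>matrix_inv A\<close>, so the
    stabilizer condition is restated for the inverse.\<close>
  have \<gamma>_H: "(\<Sum>j\<in>UNIV. [:matrix_inv A $ i $ j:] * \<gamma> j) = \<gamma> i" if "A \<in> H" for A i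
    using \<gamma>0[of "matrix_inv A"] invH[OF that] HG by blast
  have \<gamma>_G: "\<exists>i. (\<Sum>j\<in>UNIV. [:matrix_inv A $ i $ j:] * \<gamma> j) \<noteq> \<gamma> i" if "A \<in> G" "A \<notin> H" for A
    using \<gamma>0[of "matrix_inv A"] invG[OF that(1)] inv_inv[OF that(1)] invH[of "matrix_inv A"] that(2)
    by metis

  obtain \<pi>0 where \<pi>0: "range \<pi>0 = invariants G" "\<And>p q. \<pi>0 (p + q) = \<pi>0 p + \<pi>0 q"
    "\<And>a p. a \<in> invariants G \<Longrightarrow> \<pi>0 (a * p) = a * \<pi>0 p"
    using assms(3) unfolding direct_summand_property_def by blast
  have "1 \<in> invariants G" using invariants_const[of 1 G] by simp
  then obtain p0 where p0: "\<pi>0 p0 = 1" using \<pi>0(1) by (metis imageE)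
  \<comment> \<open>Multiplying first by a preimage of 1 gives a linear map that sends 1 to
    1.\<close>
  define \<pi> where "\<pi> x = \<pi>0 (p0 * x)" for x
  have \<pi>_add: "\<pi> (x + y) = \<pi> x + \<pi> y" for x y by (simp add: \<pi>_def distrib_left \<pi>0(2))
  have \<pi>_zero: "\<pi> 0 = 0" using \<pi>_add[of 0 0] by simp
  have \<pi>_sum: "\<pi> (sum u I) = (\<Sum>i\<in>I. \<pi> (u i))" for u and I :: "nat set"
    by (induction I rule: infinite_finite_induct) (auto simp: \<pi>_add \<pi>_zero)
  have \<pi>_mult: "\<pi> (a * x) = a * \<pi> x" if "a \<in> invariants G" for a x
    using \<pi>0(3)[OF that, of "p0 * x"] by (simp add: \<pi>_def mult_ac)
  have \<pi>_inv: "\<pi> x \<in> invariants G" for x using \<pi>0(1) by (auto simp: \<pi>_def)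

  let ?GS = "coeff_action ` G" and ?HS = "coeff_action ` H"
  let ?ev = "extp (eval_at \<gamma>)"
  have ev_hom: "unital_hom ?ev" by (intro extp_unital_hom eval_at_unital_hom)
  interpret ev: unital_hom ?ev by (rule ev_hom)
  have hom: "unital_hom (coeff_action A)" for A :: "'k^'n^'n"
    unfolding coeff_action_def by (intro unital_hom.map_poly_unital_hom act_unital_hom)
  interpret separated_stabilizer ?GS ?HS "map_poly \<pi>" ?ev
  proof (rule separated_stabilizer.intro)
    show "finite ?GS" using assms(1) by (simp add: finite_matrix_group_def)
    show "id \<in> ?GS" "id \<in> ?HS" by (intro coeff_action_group assms grp_H)+
    show "?HS \<subseteq> ?GS" using HG by blast
    show "f \<circ> g \<in> ?GS" if "f \<in> ?GS" "g \<in> ?GS" for f g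
      using that by (rule coeff_action_group(2)[OF assms(1)])
    show "f \<circ> g \<in> ?HS" if "f \<in> ?HS" "g \<in> ?HS" for f g
      using that by (rule coeff_action_group(2)[OF grp_H])
    show "\<exists>g\<in>?GS. g \<circ> f = id" if "f \<in> ?GS" for f
      using coeff_action_group(3)[OF assms(1) that] by blast
    show "\<exists>g\<in>?HS. g \<circ> f = id \<and> f \<circ> g = id" if "f \<in> ?HS" for f
      using that by (rule coeff_action_group(3)[OF grp_H])
    show "unital_hom f" if "f \<in> ?GS" for f using that hom by blast
    show "unital_hom ?ev" by (rule ev_hom)
    show "map_poly \<pi> (x + y) = map_poly \<pi> x + map_poly \<pi> y" for x y
      by (rule poly_eqI) (simp add: coeff_map_poly \<pi>_zero \<pi>_add)
    \<comment> \<open>The coefficients of a fixed polynomial are invariants, so linearity passes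
      through each convolution sum.\<close>
    show "map_poly \<pi> (a * x) = a * map_poly \<pi> x" if "a \<in> fixed_by ?GS" for a x
      using that
      by (intro poly_eqI)
         (simp add: fixed_by_coeff_action coeff_map_poly \<pi>_zero coeff_mult \<pi>_sum \<pi>_mult)
    show "map_poly \<pi> x \<in> fixed_by ?GS" for x
      by (simp add: fixed_by_coeff_action coeff_map_poly \<pi>_zero \<pi>_inv)
    show "map_poly \<pi> 1 = 1" by (simp add: \<pi>_def p0)
    show "?ev (f x) = ?ev x" if f: "f \<in> ?HS" for f x
    proof -
      obtain A where A: "A \<in> H" "f = coeff_action A" using f by blast
      show ?thesis
        unfolding A(2) coeff_action_def extp_def
        by (simp add: map_poly_map_poly o_def unital_hom.zero[OF act_unital_hom]
            unital_hom.zero[OF eval_at_unital_hom] eval_at_act[OF \<gamma>_H[OF A(1)]])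
    qed
    show "\<exists>g. ?ev (f g) = 0 \<and> ?ev g \<noteq> 0" if f: "f \<in> ?GS" "f \<notin> ?HS" for f
    proof -
      obtain A where A: "A \<in> G" "A \<notin> H" "f = coeff_action A" using f by blast
      obtain i where i: "eval_at \<gamma> (act A (var i)) \<noteq> \<gamma> i"
        using \<gamma>_G[OF A(1,2)] by (metis eval_at_act_var)
      \<comment> \<open>\<open>a\<close> is coordinate \<open>i\<close> of the point moved by the
        inverse of \<open>A\<close>, and it differs from \<open>\<gamma> i\<close>. The witness
        below, \<open>var i\<close> minus \<open>a\<close>, vanishes at the point after
        \<open>f\<close> is applied, but has the value \<open>\<gamma> i - a\<close> before.\<close>
      define a where "a = eval_at \<gamma> (act A (var i))"
      interpret f: unital_hom f using A(3) hom by simp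
      have ev_a: "?ev (map_poly const a) = a"
        using extp_map_const[OF eval_at_unital_hom, of \<gamma> "\<lambda>c. c" a] by (simp add: unital_hom_def)
      have f_a: "f (map_poly const a) = map_poly const a"
        by (simp add: A(3) coeff_action_def map_poly_map_poly o_def unital_hom.zero[OF act_unital_hom])
      have f_var: "f [:var i:] = [:act A (var i):]"
        by (simp add: A(3) coeff_action_def unital_hom.map_poly_pCons[OF act_unital_hom])
      show ?thesis
      proof (intro exI[of _ "[:var i:] - map_poly const a"] conjI)
        show "?ev (f ([:var i:] - map_poly const a)) = 0"
          by (simp add: f.diff ev.diff ev_a f_a f_var eval_at_unital_hom a_def[symmetric])
        show "?ev ([:var i:] - map_poly const a) \<noteq> 0"
          using i by (auto simp: ev.diff ev_a eval_at_unital_hom a_def[symmetric])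
      qed
    qed
    show "x = 0" if "?ev s \<noteq> 0" "s * x = 0" for s x
      using that poly_coord_ring_no_zero_divisors[of s x] by auto
  qed
  obtain \<phi> where \<phi>_add: "\<And>x y. \<phi> (x + y) = \<phi> x + \<phi> y"
    and \<phi>_mult: "\<And>c x. c \<in> fixed_by ?HS \<Longrightarrow> \<phi> (c * x) = c * \<phi> x"
    and \<phi>_fixed: "\<And>x. \<phi> x \<in> fixed_by ?HS" and \<phi>_one: "?ev (\<phi> 1) \<noteq> 0"
    using exists_linear_map_nonvanishing by blast

  let ?T = "extp (translate \<gamma>)" and ?T' = "translate (\<lambda>i. - \<gamma> i)"
  interpret T: unital_hom ?T by (intro extp_unital_hom translate_unital_hom)
  interpret T': unital_hom ?T' by (rule translate_unital_hom)
  have \<gamma>_H': "(\<Sum>j\<in>UNIV. [:matrix_inv A $ i $ j:] * - \<gamma> j) = - \<gamma> i" if "A \<in> H" for A i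
    using \<gamma>_H[OF that, of i] by (simp add: sum_negf)
  have T_fixed: "?T q \<in> fixed_by ?HS" if "q \<in> fixed_by ?HS" for q
  proof (rule fixed_byI)
    fix f assume f: "f \<in> ?HS"
    then obtain A where A: "A \<in> H" "f = coeff_action A" by blast
    show "f (?T q) = ?T q"
      using extp_translate_act[OF \<gamma>_H[OF A(1)], of q] fixed_byD[OF that f]
      by (simp add: A(2) coeff_action_def)
  qed
  \<comment> \<open>The opposite point is fixed by \<open>H\<close> too, so this translation sends
    invariants of \<open>H\<close> into the ring over which \<open>\<phi>\<close> is linear.\<close>
  have T'_fixed: "?T' c \<in> fixed_by ?HS" if "c \<in> invariants H" for c
  proof (rule fixed_byI)
    fix f assume f: "f \<in> ?HS"
    then obtain A where A: "A \<in> H" "f = coeff_action A" by blast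
    show "f (?T' c) = ?T' c"
      using translate_act[OF \<gamma>_H'[OF A(1)], of c] that A
      by (simp add: coeff_action_def invariants_def)
  qed
  \<comment> \<open>The constant terms of the translate assemble to the value at
    \<open>\<gamma>\<close>, so some coefficient in T has a non-zero constant term.\<close>
  have "map_poly (\<lambda>p. Poly_Mapping.lookup p 0) (?T (\<phi> 1)) \<noteq> 0"
    using \<phi>_one by (simp add: constant_term_translate)
  then obtain j where j: "Poly_Mapping.lookup (coeff (?T (\<phi> 1)) j) 0 \<noteq> 0"
    by (auto simp: poly_eq_iff coeff_map_poly)
  show ?thesis
    unfolding H_def[symmetric]
  proof (rule direct_summand_propertyI[where \<phi> = "\<lambda>x. coeff (?T (\<phi> (?T' x))) j"])
    show "coeff (?T (\<phi> (?T' (x + y)))) j = coeff (?T (\<phi> (?T' x))) j + coeff (?T (\<phi> (?T' y))) j" for x y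
      by (simp add: T'.add \<phi>_add T.add)
    \<comment> \<open>\<open>?T\<close> undoes \<open>?T'\<close> on \<open>a\<close> and leaves a
      polynomial constant in T, so taking the coefficient at \<open>j\<close> commutes with
      multiplication by \<open>a\<close>.\<close>
    show "coeff (?T (\<phi> (?T' (a * x)))) j = a * coeff (?T (\<phi> (?T' x))) j" if "a \<in> invariants H" for a x
      by (simp add: T'.mult \<phi>_mult T'_fixed that T.mult translate_translate_uminus)
    show "coeff (?T (\<phi> (?T' x))) j \<in> invariants H" for x
      using T_fixed[OF \<phi>_fixed] by (simp add: fixed_by_coeff_action)
    show "Poly_Mapping.lookup (coeff (?T (\<phi> (?T' 1))) j) 0 \<noteq> 0"
      using j by simp
  qed
qed

end
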